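(* Assume that $V\in\mathfrak{C}^s(\Omega)$ with $s\ge0$. Then any eigenfunction of the Dirichlet eigenvalue problem $$-\Delta u+Vu=\lambda u\ \text{ in }\Omega,\qquad u=0\ \text{ on }\partial\Omega,$$ lies in $\mathfrak{B}^{s+2}(\Omega)$.
   Context: $\Omega=(0,1)^d$, $d\ge1$; $V$ is real-valued. Eigenfunctions are nonzero $u\in H_0^1(\Omega)$ satisfying the equation weakly for some $\lambda\in\mathbb{R}$. Cosine spectral Barron space: for $k\in\mathbb{N}_0^d$ let $\Psi_k(x)=\prod_{i=1}^d\cos(\pi k_ix_i)$, and for $w\in L^1(\Omega)$ let $\check w(k)$ be its Fourier coefficients with respect to $\{\Psi_k\}$, i.e. $\check w(k)=2^{\#\{i:k_i\ne0\}}\int_\Omega w\Psi_k\,dx$. Then $\|w\|_{\mathfrak{C}^s(\Omega)}=\sum_{k\in\mathbb{N}_0^d}(1+\pi^s|k|_1^s)|\check w(k)|$ and $\mathfrak{C}^s(\Omega)=\{w\in L^1(\Omega):\|w\|_{\mathfrak{C}^s(\Omega)}<\infty\}$. Sine spectral Barron space: for $k\in\mathbb{N}_+^d$ let $\Phi_k(x)=\prod_{i=1}^d\sin(\pi k_ix_i)$, $\hat u(k)=2^d\int_\Omega u\Phi_k\,dx$, $\|u\|_{\mathfrak{B}^s(\Omega)}=\sum_{k\in\mathbb{N}_+^d}(1+\pi^s|k|_1^s)|\hat u(k)|$ and $\mathfrak{B}^s(\Omega)=\{u\in L^1(\Omega):\|u\|_{\mathfrak{B}^s(\Omega)}<\infty\}$.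 Here $|k|_1$ is the $\ell^1$-norm. *)

theory Defs
  imports "HOL-Analysis.Analysis"
begin

definition unit_cube :: "(real^'n) set" where
  "unit_cube = box 0 1"

abbreviation cube_measure :: "(real^'n) measure" where
  "cube_measure \<equiv> lebesgue_on unit_cube"

definition partial_derivative :: "'n \<Rightarrow> (real^'n \<Rightarrow> real) \<Rightarrow> real^'n \<Rightarrow> real" where
  "partial_derivative i f x = frechet_derivative f (at x) (axis i 1)"

definition grad :: "(real^'n \<Rightarrow> real) \<Rightarrow> real^'n \<Rightarrow> real^'n" where
  "grad f x = (\<chi> i. partial_derivative i f x)"

primrec continuously_differentiable :: "nat \<Rightarrow> (real^'n \<Rightarrow> real) \<Rightarrow> bool" where
  "continuously_differentiable 0 f \<longleftrightarrow> continuous_on UNIV f"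
| "continuously_differentiable (Suc m) f \<longleftrightarrow>
     f differentiable_on UNIV \<and> (\<forall>i. continuously_differentiable m (partial_derivative i f))"

text \<open>The space of smooth functions with compact support in the cube, each function being
  extended by zero to the whole space.\<close>

definition test_functions :: "(real^'n \<Rightarrow> real) set" where
  "test_functions = {\<phi>. (\<forall>m. continuously_differentiable m \<phi>) \<and>
     (\<exists>K. compact K \<and> K \<subseteq> unit_cube \<and> (\<forall>x. x \<notin> K \<longrightarrow> \<phi> x = 0))}"

text \<open>Throughout, elements of Lebesgue and Sobolev spaces are represented by functions on the
  whole space whose values outside the cube are irrelevant, and they are not identified when
  they agree almost everywhere.\<close>

definition L2 :: "(real^'n \<Rightarrow> 'b::real_normed_vector) set" where
  "L2 = {f. f \<in> borel_measurable cube_measure \<and> integrable cube_measure (\<lambda>x. (norm (f x))\<^sup>2)}"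

definition has_weak_gradient :: "(real^'n \<Rightarrow> real) \<Rightarrow> (real^'n \<Rightarrow> real^'n) \<Rightarrow> bool" where
  "has_weak_gradient u G \<longleftrightarrow> G \<in> L2 \<and>
     (\<forall>\<phi>\<in>test_functions.
        (\<integral>x. u x *\<^sub>R grad \<phi> x \<partial>cube_measure) = - (\<integral>x. \<phi> x *\<^sub>R G x \<partial>cube_measure))"

definition H1 :: "(real^'n \<Rightarrow> real) set" where
  "H1 = {u \<in> L2. \<exists>G. has_weak_gradient u G}"

text \<open>The weak gradient of a function in \<open>H1\<close> is unique up to a null set, so the choice below
  does not matter under integrals.\<close>

definition weak_grad :: "(real^'n \<Rightarrow> real) \<Rightarrow> real^'n \<Rightarrow> real^'n" where
  "weak_grad u = (SOME G. has_weak_gradient u G)"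

text \<open>The closure of the test functions in the \<open>H1\<close> norm. For a test function the classical
  gradient represents the weak one.\<close>

definition H1_0 :: "(real^'n \<Rightarrow> real) set" where
  "H1_0 = {u \<in> H1. \<exists>\<phi>. (\<forall>j::nat. \<phi> j \<in> test_functions) \<and>
     (\<lambda>j. sqrt ((\<integral>x. (\<phi> j x - u x)\<^sup>2 \<partial>cube_measure) +
                (\<integral>x. (norm (grad (\<phi> j) x - weak_grad u x))\<^sup>2 \<partial>cube_measure))) \<longlonglongrightarrow> 0}"

text \<open>The integral of \<open>V u v\<close> is a Bochner integral, which is \<open>0\<close> by convention if the
  integrand is not integrable. For \<open>V\<close> in a cosine Barron space with \<open>s \<ge> 0\<close> this never happens,
  because \<open>V\<close> is then essentially bounded.\<close>

definition dirichlet_eigenfunction ::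
    "(real^'n \<Rightarrow> real) \<Rightarrow> real \<Rightarrow> (real^'n \<Rightarrow> real) \<Rightarrow> bool" where
  "dirichlet_eigenfunction V lam u \<longleftrightarrow>
     u \<in> H1_0 \<and> \<not> (AE x in cube_measure. u x = 0) \<and>
     (\<forall>v\<in>H1_0.
        (\<integral>x. weak_grad u x \<bullet> weak_grad v x \<partial>cube_measure) +
        (\<integral>x. V x * u x * v x \<partial>cube_measure) =
        lam * (\<integral>x. u x * v x \<partial>cube_measure))"

definition l1_norm :: "nat^'n \<Rightarrow> real" where
  "l1_norm k = (\<Sum>i\<in>UNIV. real (k $ i))"

text \<open>Since \<open>0 powr 0 = 0\<close>, for \<open>s = 0\<close> and \<open>k = 0\<close> the weight is \<open>1\<close> rather than \<open>2\<close>. This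
  concerns a single term of the cosine norm and does not affect membership in the space.\<close>

definition barron_weight :: "real \<Rightarrow> nat^'n \<Rightarrow> real" where
  "barron_weight s k = 1 + pi powr s * l1_norm k powr s"

definition cos_basis :: "nat^'n \<Rightarrow> real^'n \<Rightarrow> real" where
  "cos_basis k x = (\<Prod>i\<in>UNIV. cos (pi * real (k $ i) * x $ i))"

definition cosine_coefficient :: "(real^'n \<Rightarrow> real) \<Rightarrow> nat^'n \<Rightarrow> real" where
  "cosine_coefficient w k = 2 ^ card {i. k $ i \<noteq> 0} * (\<integral>x. w x * cos_basis k x \<partial>cube_measure)"

definition cosine_barron_norm :: "real \<Rightarrow> (real^'n \<Rightarrow> real) \<Rightarrow> ennreal" where
  "cosine_barron_norm s w = (\<Sum>\<^sub>\<infinity>k. ennreal (barron_weight s k * \<bar>cosine_coefficient w k\<bar>))"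

definition cosine_barron :: "real \<Rightarrow> (real^'n \<Rightarrow> real) set" where
  "cosine_barron s = {w. integrable cube_measure w \<and> cosine_barron_norm s w < \<infinity>}"

definition sin_basis :: "nat^'n \<Rightarrow> real^'n \<Rightarrow> real" where
  "sin_basis k x = (\<Prod>i\<in>UNIV. sin (pi * real (k $ i) * x $ i))"

definition sine_coefficient :: "(real^'n \<Rightarrow> real) \<Rightarrow> nat^'n \<Rightarrow> real" where
  "sine_coefficient u k = 2 ^ CARD('n) * (\<integral>x. u x * sin_basis k x \<partial>cube_measure)"

definition sine_barron_norm :: "real \<Rightarrow> (real^'n \<Rightarrow> real) \<Rightarrow> ennreal" where
  "sine_barron_norm s u =
     (\<Sum>\<^sub>\<infinity>k\<in>{k. \<forall>i. 0 < k $ i}. ennreal (barron_weight s k * \<bar>sine_coefficient u k\<bar>))"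

definition sine_barron :: "real \<Rightarrow> (real^'n \<Rightarrow> real) set" where
  "sine_barron s = {u. integrable cube_measure u \<and> sine_barron_norm s u < \<infinity>}"

end

theory Submission imports Defs begin

text \<open>
Write \<open>a k\<close> for the integral of \<open>u\<close> against the sine product \<open>\<Phi>\<^sub>k\<close> and \<open>v\<close> for the
cosine coefficients of \<open>V\<close>. Tested with \<open>\<Phi>\<^sub>k\<close>, the eigenvalue equation becomes
\<open>(\<pi>\<^sup>2 \<bar>k\<bar>\<^sup>2 - \<lambda>) a k = - \<integral> V u \<Phi>\<^sub>k\<close> (\<open>eigenfunction_fourier_equation\<close>). Because \<open>v\<close> is summable,
\<open>V\<close> is almost everywhere the sum of its cosine series, and a product of a sine and a cosine
product is an average of \<open>2\<^sup>d\<close> signed sine products. Hence the right-hand side is bounded by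
\<open>(Q \<bar>a\<bar>) k\<close>, where \<open>Q\<close> is a convolution with \<open>\<bar>v\<bar>\<close> in which the frequencies are reflected at the
coordinate hyperplanes (\<open>eigenfunction_convolution_bound\<close>).

The weight of the Barron norm of order \<open>s\<close> is submultiplicative up to a constant, so \<open>Q\<close> is
bounded both on bounded sequences and on the weighted \<open>\<ell>\<^sup>1\<close> space of order \<open>s\<close>
(\<open>reflected_convolution_const\<close>, \<open>reflected_convolution_weighted\<close>). Outside a finite set of
frequencies the factor \<open>\<pi>\<^sup>2 \<bar>k\<bar>\<^sup>2 - \<lambda>\<close> is so large that dividing by it turns \<open>Q\<close> into a contraction
by \<open>1/2\<close> on both spaces. Therefore \<open>\<bar>a\<bar> \<le> g + S \<bar>a\<bar>\<close> with \<open>g\<close> finitely supported and \<open>S\<close> a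
contraction. Iterating the inequality, which starts from nothing more than the boundedness of \<open>a\<close>,
dominates \<open>\<bar>a\<bar>\<close> by a Neumann series that converges in the weighted \<open>\<ell>\<^sup>1\<close> space
(\<open>weighted_sum_finite_of_contraction\<close>). This puts \<open>u\<close> into the space of order \<open>s\<close> in a single
step, whatever the dimension. One more use of the equation, as \<open>\<pi>\<^sup>2 \<bar>k\<bar>\<^sup>2 \<bar>a k\<bar> \<le> \<bar>\<lambda>\<bar> \<bar>a k\<bar> + (Q \<bar>a\<bar>) k\<close>, gains the two remaining orders.

Two analytic facts carry the equation for the coefficients. An integrable function on the cube whose
cosine coefficients all vanish is zero almost everywhere (\<open>cos_coeffs_zero_imp_AE_zero\<close>); this
gives both the cosine series of \<open>V\<close> and the uniqueness of weak gradients. And \<open>\<Phi>\<^sub>k\<close> may be used as a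
test function although its support is not compact: multiplied by cutoffs \<open>\<chi>\<^sub>j\<close> that tend to \<open>1\<close>
it is a test function, and its gradients stay bounded because \<open>\<Phi>\<^sub>k\<close> vanishes on the boundary, where
the derivatives of the cutoffs blow up.
\<close>

section \<open>Weighted summability by contraction\<close>

lemma infsum_ennreal_eq_nn_integral:
  fixes f :: "'a::countable \<Rightarrow> ennreal"
  shows "(\<Sum>\<^sub>\<infinity>k\<in>A. f k) = (\<integral>\<^sup>+k. f k * indicator A k \<partial>count_space UNIV)"
proof -
  define g where "g = (\<lambda>k. f k * indicator A k)"
  define E where "E n = {k::'a. to_nat k < n}" for n
  have finE: "finite (E n)" for n
    unfolding E_def by (rule finite_imageD[where f=to_nat]) (auto intro: finite_subset[of _ "{..<n}"] inj_onI)
  have fin: "(\<integral>\<^sup>+k. g k * indicator F k \<partial>count_space UNIV) = sum g F" if "finite F" for F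
  proof -
    have "(\<integral>\<^sup>+k. g k * indicator F k \<partial>count_space UNIV) = (\<integral>\<^sup>+k. g k \<partial>count_space F)"
      by (subst nn_integral_count_space_indicator) (auto simp: mult.commute)
    then show ?thesis using that by (simp add: nn_integral_count_space_finite)
  qed
  have "infsum f A = infsum g UNIV"
    unfolding g_def by (rule infsum_cong_neutral) auto
  also have "\<dots> = (SUP F\<in>{F. finite F \<and> F \<subseteq> UNIV}. sum g F)"
    by (rule nonneg_infsum_complete) auto
  also have "\<dots> = (\<integral>\<^sup>+k. g k \<partial>count_space UNIV)"
  proof (rule antisym)
    show "(SUP F\<in>{F. finite F \<and> F \<subseteq> UNIV}. sum g F) \<le> (\<integral>\<^sup>+k. g k \<partial>count_space UNIV)"
    proof (rule SUP_least, clarify)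
      fix F :: "'a set" assume "finite F"
      then show "sum g F \<le> (\<integral>\<^sup>+k. g k \<partial>count_space UNIV)"
        by (subst fin[symmetric]) (auto intro!: nn_integral_mono simp: indicator_def)
    qed
    have "(SUP n. g k * indicator (E n) k) = g k" for k
    proof (rule antisym)
      show "g k \<le> (SUP n. g k * indicator (E n) k)"
        by (rule SUP_upper2[of "Suc (to_nat k)"]) (auto simp: E_def)
    qed (auto intro!: SUP_least simp: indicator_def)
    then have "(\<integral>\<^sup>+k. g k \<partial>count_space UNIV) = (\<integral>\<^sup>+k. (SUP n. g k * indicator (E n) k) \<partial>count_space UNIV)"
      by simp
    also have "\<dots> = (SUP n. (\<integral>\<^sup>+k. g k * indicator (E n) k \<partial>count_space UNIV))"
      by (rule nn_integral_monotone_convergence_SUP)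
         (auto simp: E_def incseq_def le_fun_def indicator_def)
    also have "\<dots> = (SUP n. sum g (E n))" using fin finE by simp
    also have "\<dots> \<le> (SUP F\<in>{F. finite F \<and> F \<subseteq> UNIV}. sum g F)"
      by (rule SUP_mono) (use finE in auto)
    finally show "(\<integral>\<^sup>+k. g k \<partial>count_space UNIV) \<le> (SUP F\<in>{F. finite F \<and> F \<subseteq> UNIV}. sum g F)" .
  qed
  finally show ?thesis unfolding g_def .
qed

text \<open>Iterating \<open>b \<le> g + S b\<close> from the bound \<open>b \<le> M\<close> gives \<open>b \<le> h n + M / 2 ^ n\<close>, where \<open>h n\<close> is the
\<open>n\<close>-th partial Neumann sum of \<open>g\<close>. The error is controlled by contractivity on constants, the
weighted norm of \<open>h n\<close> by contractivity in that norm, and the limit \<open>n \<rightarrow> \<infinity>\<close> only needs monotone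
convergence. The gain is that the mere boundedness of \<open>b\<close> turns into weighted summability.\<close>

lemma weighted_sum_finite_of_contraction:
  fixes b g w :: "'a \<Rightarrow> ennreal" and S :: "('a \<Rightarrow> ennreal) \<Rightarrow> 'a \<Rightarrow> ennreal"
  assumes mono: "\<And>f h k. (\<And>k. f k \<le> h k) \<Longrightarrow> S f k \<le> S h k"
    and sub: "\<And>f h k. S (\<lambda>k. f k + h k) k \<le> S f k + S h k"
    and const: "\<And>c k. S (\<lambda>_. c) k \<le> c / 2"
    and contr: "\<And>f. (\<integral>\<^sup>+k. w k * S f k \<partial>count_space UNIV) \<le> (\<integral>\<^sup>+k. w k * f k \<partial>count_space UNIV) / 2"
    and b: "\<And>k. b k \<le> g k + S b k"
    and bound: "\<And>k. b k \<le> M" "M < \<infinity>"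
    and g: "(\<integral>\<^sup>+k. w k * g k \<partial>count_space UNIV) < \<infinity>"
  shows "(\<integral>\<^sup>+k. w k * b k \<partial>count_space UNIV) < \<infinity>"
proof -
  define N where "N f = (\<integral>\<^sup>+k. w k * f k \<partial>count_space UNIV)" for f
  define h where "h = rec_nat (\<lambda>_. 0) (\<lambda>_ f k. g k + S f k)"
  have h0: "h 0 = (\<lambda>_. 0)" and hS: "h (Suc n) = (\<lambda>k. g k + S (h n) k)" for n
    by (auto simp: h_def)
  have half: "(2 * a) / 2 = a" for a :: ennreal
    by (simp add: ennreal_mult_divide_eq mult.commute)
  have Nh: "N (h n) \<le> 2 * N g" for n
  proof (induction n)
    case 0 show ?case by (simp add: h0 N_def)
  next
    case (Suc n)
    have "N (h (Suc n)) = N g + N (S (h n))"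
      unfolding N_def hS by (subst nn_integral_add[symmetric]) (auto simp: distrib_left)
    also have "\<dots> \<le> N g + N (h n) / 2" using contr[of "h n"] unfolding N_def by (intro add_mono) auto
    also have "\<dots> \<le> N g + (2 * N g) / 2" by (intro add_mono divide_right_mono_ennreal Suc) auto
    also have "\<dots> = N g + N g" by (simp only: half)
    also have "\<dots> = 2 * N g" by (simp add: mult_2)
    finally show ?case .
  qed
  obtain m where m: "M = ennreal m" "m \<ge> 0" using bound(2) by (cases M) auto
  have bh: "b k \<le> h n k + ennreal (m / 2 ^ n)" for n k
  proof (induction n arbitrary: k)
    case 0 show ?case using bound(1) m by (simp add: h0)
  next
    case (Suc n)
    have "b k \<le> g k + S b k" by (rule b)
    also have "\<dots> \<le> g k + S (\<lambda>k. h n k + ennreal (m / 2 ^ n)) k" by (intro add_mono mono Suc order_refl)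
    also have "\<dots> \<le> g k + (S (h n) k + S (\<lambda>_. ennreal (m / 2 ^ n)) k)" by (intro add_mono sub order_refl)
    also have "\<dots> \<le> g k + (S (h n) k + ennreal (m / 2 ^ n) / 2)" by (intro add_mono const order_refl)
    also have "\<dots> = h (Suc n) k + ennreal (m / 2 ^ Suc n)"
      using m(2) divide_ennreal[of "m / 2 ^ n" 2] by (simp add: hS add.assoc mult.commute)
    finally show ?case .
  qed
  have M0: "(\<lambda>n. ennreal (m / 2 ^ n)) \<longlonglongrightarrow> 0"
    using tendsto_ennrealI[OF tendsto_mult_right_zero[OF LIMSEQ_realpow_zero[of "1/2::real"], of m]]
    by (simp add: power_one_over)
  have inc: "h n k \<le> h (Suc n) k" for n k
  proof (induction n arbitrary: k)
    case (Suc n) then show ?case by (simp only: hS) (intro add_mono mono order_refl)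
  qed (simp add: h0)
  define H where "H k = (SUP n. h n k)" for k
  have bH: "b k \<le> H k" for k
  proof (rule LIMSEQ_le_const)
    show "(\<lambda>n. H k + ennreal (m / 2 ^ n)) \<longlonglongrightarrow> H k" using tendsto_add[OF tendsto_const M0] by simp
    have "h n k + ennreal (m / 2 ^ n) \<le> H k + ennreal (m / 2 ^ n)" for n
      unfolding H_def by (intro add_mono SUP_upper order_refl) auto
    then show "\<exists>N. \<forall>n\<ge>N. b k \<le> H k + ennreal (m / 2 ^ n)" using bh order_trans by blast
  qed
  have "N b \<le> N H" unfolding N_def by (intro nn_integral_mono mult_left_mono bH) auto
  also have "N H = (\<integral>\<^sup>+k. (SUP n. w k * h n k) \<partial>count_space UNIV)"
    unfolding N_def H_def by (simp add: SUP_mult_left_ennreal)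
  also have "\<dots> = (SUP n. N (h n))"
    unfolding N_def by (rule nn_integral_monotone_convergence_SUP)
      (auto simp: incseq_Suc_iff le_fun_def intro!: mult_left_mono inc)
  also have "\<dots> \<le> 2 * N g" by (rule SUP_least) (rule Nh)
  also have "\<dots> < \<infinity>" using g by (simp add: N_def ennreal_mult_less_top)
  finally show ?thesis by (simp add: N_def)
qed

section \<open>Integration over the unit cube\<close>

lemma cube_in_lebesgue [measurable]: "(unit_cube :: (real^'n) set) \<in> sets lebesgue"
  unfolding unit_cube_def by simp

lemma mem_unit_cube: "x \<in> unit_cube \<longleftrightarrow> (\<forall>i. 0 < x $ i \<and> x $ i < 1)"
  by (simp add: unit_cube_def mem_box_cart)

lemma prod_Basis_cart:
  fixes f :: "real^'n \<Rightarrow> 'b::comm_monoid_mult"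
  shows "(\<Prod>b\<in>Basis. f b) = (\<Prod>i\<in>UNIV. f (axis i 1))"
proof -
  have B: "Basis = range (\<lambda>i::'n. axis i (1::real))" by (auto simp: Basis_vec_def)
  moreover have "inj (\<lambda>i::'n. axis i (1::real))" by (auto intro!: injI simp: axis_eq_axis)
  ultimately show ?thesis by (subst B, subst prod.reindex) (auto simp: o_def)
qed

lemma prob_cube: "measure cube_measure (space (cube_measure :: (real^'n) measure)) = 1"
  and finite_measure_cube: "finite_measure (cube_measure :: (real^'n) measure)"
proof -
  have lm: "(unit_cube :: (real^'n) set) \<in> lmeasurable" by (simp add: unit_cube_def)
  then show "finite_measure (cube_measure :: (real^'n) measure)"
    by (rule finite_measure_lebesgue_on)
  have "measure lebesgue (unit_cube :: (real^'n) set) = 1"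
    unfolding unit_cube_def by (simp add: measure_completion measure_lborel_box_eq prod_Basis_cart inner_axis)
       (auto simp: Basis_vec_def inner_axis)
  then show "measure cube_measure (space (cube_measure :: (real^'n) measure)) = 1"
    using lm by (simp add: measure_restrict_space)
qed

lemma continuous_measurable_cube:
  fixes f :: "real^'n \<Rightarrow> 'b::euclidean_space"
  assumes "continuous_on UNIV f"
  shows "f \<in> borel_measurable cube_measure"
  using assms
  by (intro continuous_imp_measurable_on_sets_lebesgue) (auto intro: continuous_on_subset)

lemma integrable_mult_bounded:
  fixes f g :: "'a \<Rightarrow> real"
  assumes "integrable M f" "g \<in> borel_measurable M" "AE x in M. \<bar>g x\<bar> \<le> B"
  shows "integrable M (\<lambda>x. f x * g x)"
proof (rule Bochner_Integration.integrable_bound)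
  show "integrable M (\<lambda>x. B * f x)" using assms(1) by simp
  show "(\<lambda>x. f x * g x) \<in> borel_measurable M" using assms by auto
  show "AE x in M. norm (f x * g x) \<le> norm (B * f x)"
    using assms(3)
  proof eventually_elim
    case (elim x)
    then have "\<bar>g x\<bar> * \<bar>f x\<bar> \<le> \<bar>B\<bar> * \<bar>f x\<bar>" by (intro mult_right_mono) auto
    then show ?case by (simp add: abs_mult mult.commute)
  qed
qed

lemma continuous_bounded_cube:
  fixes f :: "real^'n \<Rightarrow> real"
  assumes "continuous_on UNIV f"
  shows "\<exists>B. \<forall>x\<in>unit_cube. \<bar>f x\<bar> \<le> B"
proof -
  have "compact (f ` cbox 0 1)"
    using assms by (intro compact_continuous_image) (auto intro: continuous_on_subset)
  from compact_imp_bounded[OF this] obtain B where B: "\<forall>y\<in>f ` cbox 0 1. norm y \<le> B"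
    unfolding bounded_iff by (rule exE)
  have closed_cube: "\<bar>f x\<bar> \<le> B" if "x \<in> cbox 0 1" for x
    using bspec[OF B imageI[OF that]] by simp
  have "unit_cube \<subseteq> cbox (0::real^'n) 1"
    unfolding unit_cube_def by (rule box_subset_cbox)
  then show ?thesis using closed_cube by (intro exI[of _ B]) blast
qed

lemma integrable_mult_continuous:
  fixes f g :: "real^'n \<Rightarrow> real"
  assumes "integrable cube_measure f" "continuous_on UNIV g"
  shows "integrable cube_measure (\<lambda>x. f x * g x)"
proof -
  obtain B where "\<And>x. x \<in> unit_cube \<Longrightarrow> \<bar>g x\<bar> \<le> B" using continuous_bounded_cube[OF assms(2)] by blast
  then show ?thesis
    by (intro integrable_mult_bounded[where B=B] assms continuous_measurable_cube)
       (auto intro!: AE_I2)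
qed

lemma integrable_const_cube: "integrable (cube_measure :: (real^'n) measure) (\<lambda>_. c::real)"
  using finite_measure.integrable_const[OF finite_measure_cube] .

lemma integrable_continuous_cube:
  fixes g :: "real^'n \<Rightarrow> real"
  assumes "continuous_on UNIV g"
  shows "integrable cube_measure g"
  using integrable_mult_continuous[OF integrable_const_cube[of 1] assms] by simp

lemma continuous_cos_basis: "continuous_on UNIV (cos_basis k)"
  unfolding cos_basis_def by (intro continuous_intros)

lemma continuous_sin_basis: "continuous_on UNIV (sin_basis k)"
  unfolding sin_basis_def by (intro continuous_intros)

lemma abs_cos_basis_le: "\<bar>cos_basis k x\<bar> \<le> 1"
  unfolding cos_basis_def abs_prod by (rule prod_le_1) auto

lemma abs_sin_basis_le: "\<bar>sin_basis k x\<bar> \<le> 1"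
  unfolding sin_basis_def abs_prod by (rule prod_le_1) auto

text \<open>The indicator of the cube is itself a product of indicators, so this is Fubini for the description of
Lebesgue measure as a product over the basis. The one-dimensional integrals are taken over the
closed interval, which is the form that the fundamental theorem of calculus needs.\<close>

lemma integral_cube_prod:
  fixes f :: "'n::finite \<Rightarrow> real \<Rightarrow> real"
  assumes cont: "\<And>i. continuous_on UNIV (f i)"
  shows "(\<integral>x. (\<Prod>i\<in>UNIV. f i (x $ i)) \<partial>(cube_measure :: (real^'n) measure))
       = (\<Prod>i\<in>UNIV. (\<integral>t. indicator {0..1} t * f i t \<partial>lborel))"
proof -
  interpret product_sigma_finite "\<lambda>_::real^'n. lborel :: real measure" ..
  define F where "F = (\<lambda>i t. indicator {0<..<1} t * f i t)"
  define h where "h b = F (THE i. b = axis i 1)" for b :: "real^'n"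
  have h: "h (axis i 1) = F i" for i unfolding h_def by (simp add: axis_eq_axis)
  have [measurable]: "f i \<in> borel_measurable borel" for i
    using cont by (intro borel_measurable_continuous_onI)
  have [measurable]: "F i \<in> borel_measurable borel" for i unfolding F_def by measurable
  have int: "integrable lborel (F i)" for i
  proof -
    have "set_integrable lborel {0..1} (f i)"
      by (rule borel_integrable_atLeastAtMost') (use cont in \<open>auto intro: continuous_on_subset\<close>)
    then have "set_integrable lborel {0<..<1} (f i)" by (rule set_integrable_subset) auto
    then show ?thesis by (simp add: set_integrable_def F_def)
  qed
  have ind: "indicator unit_cube x * (\<Prod>i\<in>UNIV. f i (x $ i)) = (\<Prod>i\<in>UNIV. F i (x $ i))" for x :: "real^'n"
  proof (cases "x \<in> unit_cube")
    case True then show ?thesis by (simp add: F_def mem_unit_cube)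
  next
    case False
    then obtain i where "\<not> (0 < x $ i \<and> x $ i < 1)" by (auto simp: mem_unit_cube)
    then have "F i (x $ i) = 0" by (auto simp: F_def)
    then have "(\<Prod>i\<in>UNIV. F i (x $ i)) = 0" by (auto simp: prod_zero_iff)
    then show ?thesis using False by simp
  qed
  have m: "(\<lambda>x::real^'n. \<Prod>i\<in>UNIV. F i (x $ i)) \<in> borel_measurable borel"
    by (intro borel_measurable_prod) (use measurable_compose[OF borel_measurable_nth] in auto)
  have "(\<integral>x. (\<Prod>i\<in>UNIV. f i (x $ i)) \<partial>(cube_measure :: (real^'n) measure))
      = (\<integral>x. (\<Prod>i\<in>UNIV. F i (x $ i)) \<partial>lebesgue)"
    by (subst integral_restrict_space) (auto simp: ind[symmetric])
  also have "\<dots> = (\<integral>x. (\<Prod>i\<in>UNIV. F i (x $ i)) \<partial>lborel)"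
    by (rule integral_completion) (use m in simp)
  also have "\<dots> = (\<integral>y. (\<Prod>i\<in>UNIV. F i ((\<Sum>b\<in>Basis. y b *\<^sub>R b) $ i))
      \<partial>(\<Pi>\<^sub>M b\<in>(Basis::(real^'n) set). lborel))"
    by (subst lborel_eq, subst integral_distr) (use m in auto)
  also have "\<dots> = (\<integral>y. (\<Prod>b\<in>Basis. h b (y b)) \<partial>(\<Pi>\<^sub>M b\<in>(Basis::(real^'n) set). lborel))"
  proof (rule arg_cong[where f="integral\<^sup>L _"], rule ext)
    fix y :: "real^'n \<Rightarrow> real"
    have "(\<Sum>b\<in>Basis. y b *\<^sub>R b) $ i = y (axis i 1)" for i
    proof -
      have "(\<Sum>b\<in>Basis. y b *\<^sub>R b) \<bullet> axis i 1 = y (axis i 1)"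
        by (rule inner_sum_left_Basis) (auto simp: Basis_vec_def)
      then show ?thesis by (simp add: inner_axis)
    qed
    then show "(\<Prod>i\<in>UNIV. F i ((\<Sum>b\<in>Basis. y b *\<^sub>R b) $ i)) = (\<Prod>b\<in>Basis. h b (y b))"
      by (simp add: prod_Basis_cart h)
  qed
  also have "\<dots> = (\<Prod>b\<in>(Basis::(real^'n) set). integral\<^sup>L lborel (h b))"
    by (rule product_integral_prod) (auto simp: Basis_vec_def h int)
  also have "\<dots> = (\<Prod>i\<in>UNIV. integral\<^sup>L lborel (F i))" by (simp add: prod_Basis_cart h)
  also have "\<dots> = (\<Prod>i\<in>UNIV. (\<integral>t. indicator {0..1} t * f i t \<partial>lborel))"
  proof (rule prod.cong[OF refl], rule integral_cong_AE)
    fix i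
    have "AE t in lborel. t \<notin> {0,1::real}"
      by (intro AE_not_in finite_imp_null_set_lborel) auto
    then show "AE t in lborel. F i t = indicator {0..1} t * f i t"
      by eventually_elim (auto simp: F_def indicator_def)
  qed auto
  finally show ?thesis .
qed

section \<open>Orthogonality and completeness of the cosine products\<close>

lemma integral_cos_pi_int:
  fixes n :: int
  shows "(\<integral>t. indicator {0..1} t * cos (pi * of_int n * t) \<partial>lborel) = (if n = 0 then 1 else 0)"
proof (cases "n = 0")
  case True then show ?thesis by simp
next
  case False
  have "has_bochner_integral lborel (\<lambda>t. cos (pi * of_int n * t) * indicator {0..1} t)
     (sin (pi * of_int n * 1) / (pi * of_int n) - sin (pi * of_int n * 0) / (pi * of_int n))"
    by (rule has_bochner_integral_FTC_Icc_real)
       (use False in \<open>auto intro!: derivative_eq_intros continuous_intros\<close>)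
  moreover have "sin (pi * of_int n) = 0" using sin_zero_iff_int2 by (metis mult.commute)
  ultimately show ?thesis using False
    by (simp add: has_bochner_integral_iff mult.commute)
qed

lemma integral_cos_cos:
  fixes m k :: nat
  shows "(\<integral>t. indicator {0..1} t * (cos (pi * real m * t) * cos (pi * real k * t)) \<partial>lborel)
       = (if m = k then (if k = 0 then 1 else 1 / 2) else 0)"
proof -
  have i: "integrable lborel (\<lambda>t. indicator {0..1} t * cos (pi * of_int n * t))" for n
  proof -
    have "set_integrable lborel {0..1::real} (\<lambda>t. cos (pi * of_int n * t))"
      by (rule borel_integrable_atLeastAtMost') (intro continuous_intros)
    then show ?thesis by (simp add: set_integrable_def)
  qed
  have "indicator {0..1} t * (cos (pi * real m * t) * cos (pi * real k * t))
      = (indicator {0..1} t * cos (pi * of_int (int m - int k) * t)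
       + indicator {0..1} t * cos (pi * of_int (int m + int k) * t)) / 2" for t :: real
    using cos_times_cos[of "pi * real m * t" "pi * real k * t"]
    by (cases "t \<in> {0..1}") (simp_all add: field_simps)
  then have "(\<integral>t. indicator {0..1} t * (cos (pi * real m * t) * cos (pi * real k * t)) \<partial>lborel)
     = ((\<integral>t. indicator {0..1} t * cos (pi * of_int (int m - int k) * t) \<partial>lborel)
      + (\<integral>t. indicator {0..1} t * cos (pi * of_int (int m + int k) * t) \<partial>lborel)) / 2"
    using i by (simp only: integral_divide_zero Bochner_Integration.integral_add)
  then show ?thesis unfolding integral_cos_pi_int by auto
qed

lemma cos_basis_orthogonal:
  fixes m k :: "nat^'n"
  shows "(\<integral>x. cos_basis m x * cos_basis k x \<partial>cube_measure)
       = (if m = k then 1 / 2 ^ card {i. k $ i \<noteq> 0} else 0)"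
proof -
  have "(\<integral>x. cos_basis m x * cos_basis k x \<partial>cube_measure)
      = (\<Prod>i\<in>UNIV. (if m $ i = k $ i then (if k $ i = 0 then 1 else 1 / 2) else 0))"
    unfolding cos_basis_def prod.distrib[symmetric] integral_cos_cos[symmetric]
    by (rule integral_cube_prod) (intro continuous_intros)
  also have "\<dots> = (if m = k then 1 / 2 ^ card {i. k $ i \<noteq> 0} else 0)"
  proof (cases "m = k")
    case True
    have "(\<Prod>i\<in>UNIV. (if k $ i = 0 then 1 else 1 / 2 :: real)) = (\<Prod>i\<in>{i. k $ i \<noteq> 0}. 1 / 2)"
      by (rule prod.mono_neutral_cong_right) auto
    then show ?thesis using True by (simp add: power_one_over)
  next
    case False
    then obtain i where "m $ i \<noteq> k $ i" by (auto simp: vec_eq_iff)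
    then show ?thesis using False by (subst prod_zero) (auto intro!: exI[of _ i])
  qed
  finally show ?thesis .
qed

text \<open>Multiplying by the cosine of a single coordinate moves the frequency one step up and one step down
in that coordinate. The step down from frequency \<open>0\<close> reaches \<open>-1\<close>, which has the same cosine as \<open>1\<close>.\<close>

lemma cos_coord_mult_cos_basis:
  "cos (pi * x $ i) * cos_basis m x
     = (cos_basis (\<chi> j. if j = i then m $ i + 1 else m $ j) x
      + cos_basis (\<chi> j. if j = i then (if m $ i = 0 then 1 else m $ i - 1) else m $ j) x) / 2"
proof -
  define R where "R = (\<Prod>j\<in>UNIV - {i}. cos (pi * real (m $ j) * x $ j))"
  have split: "cos_basis (\<chi> j. if j = i then n else m $ j) x = cos (pi * real n * x $ i) * R" for n
    unfolding cos_basis_def R_def by (subst prod.remove[of UNIV i]) (auto intro!: prod.cong)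
  have m: "cos_basis m x = cos (pi * real (m $ i) * x $ i) * R"
    unfolding cos_basis_def R_def by (subst prod.remove[of UNIV i]) auto
  have "cos (pi * x $ i) * cos (pi * real (m $ i) * x $ i)
      = (cos (pi * real (m $ i + 1) * x $ i)
       + cos (pi * real (if m $ i = 0 then 1 else m $ i - 1) * x $ i)) / 2"
  proof (cases "m $ i")
    case (Suc n)
    then show ?thesis
      using cos_times_cos[of "pi * real (m $ i) * x $ i" "pi * x $ i"]
      by (simp add: algebra_simps add_divide_distrib)
  qed simp
  then show ?thesis unfolding split m by (simp add: field_simps)
qed

text \<open>Let \<open>N\<close> be the space of integrable functions all of whose cosine coefficients vanish, and \<open>R\<close> the set
of continuous functions that multiply \<open>N\<close> into itself. Then \<open>R\<close> is an algebra without further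
work, it contains the cosine of each coordinate by \<open>cos_coord_mult_cos_basis\<close>, and these
separate the points of the closed cube. By Stone and Weierstrass \<open>R\<close> is uniformly dense, so that \<open>W\<close>
is orthogonal to every continuous function, and \<open>W = 0\<close> follows by approximating the sign of \<open>W\<close>.\<close>

lemma cos_coeffs_zero_imp_AE_zero:
  fixes W :: "real^'n \<Rightarrow> real"
  assumes W: "integrable cube_measure W"
    and zero: "\<And>m. (\<integral>x. W x * cos_basis m x \<partial>cube_measure) = 0"
  shows "AE x in cube_measure. W x = 0"
proof -
  define N where "N = {W :: real^'n \<Rightarrow> real. integrable cube_measure W
      \<and> (\<forall>m. (\<integral>x. W x * cos_basis m x \<partial>cube_measure) = 0)}"
  define R where "R = {f :: real^'n \<Rightarrow> real. continuous_on UNIV f \<and> (\<forall>W\<in>N. (\<lambda>x. W x * f x) \<in> N)}"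
  have Ncos: "integrable cube_measure (\<lambda>x. W x * cos_basis m x)" if "W \<in> N" for W m
    using that by (auto simp: N_def intro!: integrable_mult_continuous continuous_cos_basis)
  have coord: "(\<lambda>x. cos (pi * x $ i)) \<in> R" for i
  proof -
    have c: "continuous_on UNIV (\<lambda>x::real^'n. cos (pi * x $ i))" by (intro continuous_intros)
    moreover have "(\<lambda>x. W x * cos (pi * x $ i)) \<in> N" if "W \<in> N" for W
    proof -
      have "(\<integral>x. W x * cos (pi * x $ i) * cos_basis m x \<partial>cube_measure) = 0" for m
        unfolding mult.assoc cos_coord_mult_cos_basis
        using that Ncos[OF that] by (simp add: N_def distrib_left)
      then show ?thesis using that c by (auto simp: N_def intro!: integrable_mult_continuous)
    qed
    ultimately show ?thesis by (auto simp: R_def)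
  qed
  interpret function_ring_on R "cbox (0::real^'n) 1"
  proof
    show "compact (cbox (0::real^'n) 1)" by simp
    show "continuous_on (cbox 0 1) f" if "f \<in> R" for f
      using that continuous_on_subset by (auto simp: R_def)
    show "(\<lambda>x. f x * g x) \<in> R" if "f \<in> R" "g \<in> R" for f g
      using that by (auto simp: R_def mult.assoc[symmetric] intro!: continuous_intros)
    show "(\<lambda>x. f x + g x) \<in> R" if "f \<in> R" "g \<in> R" for f g
    proof -
      have "(\<lambda>x. W x * (f x + g x)) \<in> N" if "W \<in> N" for W
      proof -
        have f: "(\<lambda>x. W x * f x) \<in> N" and g: "(\<lambda>x. W x * g x) \<in> N"
          using that \<open>f \<in> R\<close> \<open>g \<in> R\<close> by (auto simp: R_def)
        then show ?thesis using Ncos[OF f] Ncos[OF g]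
          by (auto simp: N_def distrib_left distrib_right)
      qed
      then show ?thesis using that by (auto simp: R_def intro!: continuous_intros)
    qed
    show "(\<lambda>_. c) \<in> R" for c
      by (auto simp: R_def N_def mult.assoc mult.left_commute[of _ c] mult.commute[of _ c])
    fix x y :: "real^'n"
    assume xy: "x \<in> cbox 0 1" "y \<in> cbox 0 1" "x \<noteq> y"
    then obtain i where i: "x $ i \<noteq> y $ i" by (auto simp: vec_eq_iff)
    have "0 \<le> x $ i" "x $ i \<le> 1" "0 \<le> y $ i" "y $ i \<le> 1"
      using xy by (auto simp: mem_box_cart)
    then have "cos (pi * x $ i) \<noteq> cos (pi * y $ i)"
      using i cos_inj_pi[of "pi * x $ i" "pi * y $ i"] by auto
    then show "\<exists>f\<in>R. f x \<noteq> f y" by (intro bexI[OF _ coord[of i]])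
  qed
  have WN: "W \<in> N" using assms by (auto simp: N_def)
  have cont: "(\<integral>x. W x * f x \<partial>cube_measure) = 0" if f: "continuous_on UNIV f" for f
  proof -
    define I where "I = (\<integral>x. \<bar>W x\<bar> \<partial>cube_measure)"
    have "\<bar>\<integral>x. W x * f x \<partial>cube_measure\<bar> \<le> e * I" if "e > 0" for e
    proof -
      obtain g where g: "g \<in> R" "\<And>x. x \<in> cbox 0 1 \<Longrightarrow> \<bar>f x - g x\<bar> < e"
        using Stone_Weierstrass_basic[of f e] f \<open>e > 0\<close> continuous_on_subset by blast
      have "(\<lambda>x. W x * g x) \<in> N" using g(1) WN by (auto simp: R_def)
      \<comment> \<open>The zeroth cosine coefficient of \<open>W g\<close> is its integral, so \<open>\<integral> W g = 0\<close> for \<open>g\<close> in \<open>R\<close>.\<close>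
      moreover have "cos_basis 0 x = 1" for x :: "real^'n" by (simp add: cos_basis_def)
      ultimately have ig: "integrable cube_measure (\<lambda>x. W x * g x)"
        and z: "(\<integral>x. W x * g x \<partial>cube_measure) = 0"
        unfolding N_def by (auto, metis (no_types, lifting) mult.right_neutral Bochner_Integration.integral_cong)
      have "(\<integral>x. W x * f x \<partial>cube_measure) = (\<integral>x. W x * f x - W x * g x \<partial>cube_measure)"
        using z ig integrable_mult_continuous[OF W f] by simp
      also have "\<bar>\<dots>\<bar> \<le> (\<integral>x. e * \<bar>W x\<bar> \<partial>cube_measure)"
      proof (rule integral_abs_bound[THEN order_trans], rule integral_mono)
        fix x :: "real^'n" assume "x \<in> space cube_measure"
        then have "x \<in> cbox 0 1" using box_subset_cbox[of 0 "1::real^'n"] by (auto simp: unit_cube_def)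
        then have "\<bar>W x\<bar> * \<bar>f x - g x\<bar> \<le> \<bar>W x\<bar> * e"
          using g(2)[of x] by (intro mult_left_mono) auto
        then show "\<bar>W x * f x - W x * g x\<bar> \<le> e * \<bar>W x\<bar>"
          by (simp add: right_diff_distrib[symmetric] abs_mult mult.commute)
      qed (use W ig integrable_mult_continuous[OF W f] in auto)
      also have "\<dots> = e * I" by (simp add: I_def)
      finally show ?thesis .
    qed
    then have "\<forall>e>0. \<bar>\<integral>x. W x * f x \<partial>cube_measure\<bar> \<le> e * I" by blast
    moreover have "I \<ge> 0" unfolding I_def by simp
    ultimately have "\<bar>\<integral>x. W x * f x \<partial>cube_measure\<bar> \<le> 0 + e" if "e > 0" for e
      using that
    proof -
      have "\<bar>\<integral>x. W x * f x \<partial>cube_measure\<bar> \<le> e / (I + 1) * I"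
        using \<open>\<forall>e>0. _\<close>[rule_format, of "e / (I + 1)"] that \<open>I \<ge> 0\<close> by simp
      also have "\<dots> \<le> e" using that \<open>I \<ge> 0\<close> by (simp add: field_simps)
      finally show ?thesis by simp
    qed
    then show ?thesis using field_le_epsilon[of "\<bar>\<integral>x. W x * f x \<partial>cube_measure\<bar>" 0] by simp
  qed
  have "(\<lambda>x. sgn (W x)) \<in> borel_measurable cube_measure"
    using borel_measurable_integrable[OF W] by measurable
  then have "(\<lambda>x. if x \<in> unit_cube then sgn (W x) else 0) \<in> borel_measurable lebesgue"
    by (subst (asm) borel_measurable_if[OF cube_in_lebesgue, symmetric])
  then have "(\<lambda>x. if x \<in> unit_cube then sgn (W x) else 0) measurable_on UNIV"
    by (rule lebesgue_measurable_imp_measurable_on) simp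
  then obtain Z g where Z: "negligible Z" and gc: "\<And>n. continuous_on UNIV (g n)"
    and gl: "\<And>x. x \<notin> Z \<Longrightarrow> (\<lambda>n. g n x) \<longlonglongrightarrow> (if x \<in> unit_cube then sgn (W x) else 0)"
    unfolding measurable_on_def by auto
  \<comment> \<open>Clamping to \<open>[-1, 1]\<close> makes \<open>\<bar>W\<bar>\<close> a dominating function and does not affect the limit \<open>sgn W\<close>.\<close>
  define c where "c n x = max (-1) (min 1 (g n x))" for n x
  have cc: "continuous_on UNIV (c n)" for n
    unfolding c_def[abs_def] by (intro continuous_intros gc)
  have "(\<lambda>n. \<integral>x. W x * c n x \<partial>cube_measure) \<longlonglongrightarrow> (\<integral>x. \<bar>W x\<bar> \<partial>cube_measure)"
  proof (rule integral_dominated_convergence)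
    show "(\<lambda>x. \<bar>W x\<bar>) \<in> borel_measurable cube_measure" "integrable cube_measure (\<lambda>x. \<bar>W x\<bar>)"
      using W by auto
    show "(\<lambda>x. W x * c n x) \<in> borel_measurable cube_measure" for n
      using integrable_mult_continuous[OF W cc] by blast
    have "AE x in cube_measure. x \<notin> Z"
      using AE_not_in[of Z lebesgue] Z
      by (simp add: AE_restrict_space_iff negligible_iff_null_sets) (auto elim: eventually_mono)
    then show "AE x in cube_measure. (\<lambda>n. W x * c n x) \<longlonglongrightarrow> \<bar>W x\<bar>"
      using AE_space
    proof eventually_elim
      case (elim x)
      then have "(\<lambda>n. W x * c n x) \<longlonglongrightarrow> W x * max (-1) (min 1 (sgn (W x)))"
        unfolding c_def using gl[of x] by (intro tendsto_intros) auto
      moreover have "W x * max (-1) (min 1 (sgn (W x))) = \<bar>W x\<bar>"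
        by (auto simp: sgn_real_def abs_if)
      ultimately show ?case by simp
    qed
    have "norm (W x * c n x) \<le> \<bar>W x\<bar>" for n x
      by (auto simp: abs_mult c_def intro!: mult_left_le)
    then show "AE x in cube_measure. norm (W x * c n x) \<le> \<bar>W x\<bar>" for n by simp
  qed
  then have "(\<integral>x. \<bar>W x\<bar> \<partial>cube_measure) = 0"
    using cont[OF cc] by (simp add: LIMSEQ_const_iff)
  then show ?thesis
    using W integral_nonneg_eq_0_iff_AE[of cube_measure "\<lambda>x. \<bar>W x\<bar>"] by simp
qed

text \<open>The cosine series of \<open>V\<close> converges uniformly to a continuous function \<open>U\<close>. By orthogonality \<open>U\<close> has the
same coefficients as \<open>V\<close>, hence \<open>V = U\<close> almost everywhere. Boundedness of \<open>V\<close> and termwise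
integration against integrable functions are then inherited from \<open>U\<close>.\<close>

lemma
  fixes V :: "real^'n \<Rightarrow> real"
  assumes V: "integrable cube_measure V"
    and sm: "(\<lambda>m. \<bar>cosine_coefficient V m\<bar>) summable_on UNIV"
  shows cosine_series_bounded: "\<exists>B. AE x in cube_measure. \<bar>V x\<bar> \<le> B"
    and cosine_series_has_sum: "\<And>h. integrable cube_measure h \<Longrightarrow>
      ((\<lambda>m. cosine_coefficient V m * (\<integral>x. h x * cos_basis m x \<partial>cube_measure))
        has_sum (\<integral>x. V x * h x \<partial>cube_measure)) UNIV"
proof -
  define v where "v = cosine_coefficient V"
  define U where "U x = (\<Sum>\<^sub>\<infinity>m. v m * cos_basis m x)" for x
  define T where "T F x = (\<Sum>m\<in>F. v m * cos_basis m x)" for F x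
  have trm: "norm (v m * cos_basis m x) \<le> \<bar>v m\<bar>" for m x
    by (simp add: abs_mult abs_cos_basis_le mult_left_le)
  have unif: "uniform_limit UNIV T U (finite_subsets_at_top UNIV)"
    unfolding T_def[abs_def] U_def[abs_def] using trm sm
    by (intro Weierstrass_m_test_general) (auto simp: v_def)
  have contT: "continuous_on UNIV (T F)" for F
    unfolding T_def[abs_def] by (intro continuous_intros continuous_cos_basis)
  have contU: "continuous_on UNIV U"
    by (rule uniform_limit_theorem[OF _ unif]) (auto simp: contT)
  have hs: "((\<lambda>m. v m * (\<integral>x. h x * cos_basis m x \<partial>cube_measure))
        has_sum (\<integral>x. U x * h x \<partial>cube_measure)) UNIV" if h: "integrable cube_measure h" for h
    unfolding has_sum_def
  proof (rule tendstoI)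
    fix e :: real assume "e > 0"
    define I where "I = (\<integral>x. \<bar>h x\<bar> \<partial>cube_measure)"
    have I: "I \<ge> 0" by (simp add: I_def)
    have "\<forall>\<^sub>F F in finite_subsets_at_top UNIV. \<forall>x\<in>UNIV. dist (T F x) (U x) < e / (I + 1)"
      using unif \<open>e > 0\<close> I by (intro uniform_limitD) auto
    moreover have "\<forall>\<^sub>F F in finite_subsets_at_top (UNIV :: (nat^'n) set). finite F"
      by (rule eventually_finite_subsets_at_top_weakI) auto
    ultimately show "\<forall>\<^sub>F F in finite_subsets_at_top UNIV.
       dist (\<Sum>m\<in>F. v m * (\<integral>x. h x * cos_basis m x \<partial>cube_measure)) (\<integral>x. U x * h x \<partial>cube_measure) < e"
    proof eventually_elim
      case (elim F)
      have "(\<Sum>m\<in>F. v m * (\<integral>x. h x * cos_basis m x \<partial>cube_measure)) = (\<integral>x. h x * T F x \<partial>cube_measure)"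
      proof -
        have "(\<integral>x. h x * T F x \<partial>cube_measure) = (\<integral>x. (\<Sum>m\<in>F. v m * (h x * cos_basis m x)) \<partial>cube_measure)"
          unfolding T_def by (simp add: sum_distrib_left mult.left_commute)
        also have "\<dots> = (\<Sum>m\<in>F. (\<integral>x. v m * (h x * cos_basis m x) \<partial>cube_measure))"
          by (rule Bochner_Integration.integral_sum)
             (intro integrable_mult_right integrable_mult_continuous h continuous_cos_basis)
        finally show ?thesis by simp
      qed
      also have "dist \<dots> (\<integral>x. U x * h x \<partial>cube_measure)
           = \<bar>\<integral>x. h x * T F x - h x * U x \<partial>cube_measure\<bar>"
        using integrable_mult_continuous[OF h contT] integrable_mult_continuous[OF h contU]
        by (simp add: dist_real_def mult.commute)
      also have "\<dots> \<le> (\<integral>x. e / (I + 1) * \<bar>h x\<bar> \<partial>cube_measure)"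
      proof (rule integral_abs_bound[THEN order_trans], rule integral_mono)
        fix x :: "real^'n"
        have "\<bar>h x\<bar> * \<bar>T F x - U x\<bar> \<le> \<bar>h x\<bar> * (e / (I + 1))"
          using elim by (intro mult_left_mono) (auto simp: dist_real_def less_imp_le)
        then show "\<bar>h x * T F x - h x * U x\<bar> \<le> e / (I + 1) * \<bar>h x\<bar>"
          by (simp add: right_diff_distrib[symmetric] abs_mult) (simp add: mult.commute)
      qed (use h integrable_mult_continuous[OF h contT] integrable_mult_continuous[OF h contU] in auto)
      also have "\<dots> = e / (I + 1) * I" by (simp add: I_def)
      also have "\<dots> < e" using \<open>e > 0\<close> I by (simp add: field_simps)
      finally show ?case .
    qed
  qed
  have "AE x in cube_measure. V x - U x = 0"
  proof (rule cos_coeffs_zero_imp_AE_zero)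
    show "integrable cube_measure (\<lambda>x. V x - U x)" using V integrable_continuous_cube[OF contU] by simp
    fix k
    have "((\<lambda>m. v m * (\<integral>x. cos_basis k x * cos_basis m x \<partial>cube_measure))
        has_sum (\<integral>x. U x * cos_basis k x \<partial>cube_measure)) UNIV"
      by (rule hs) (rule integrable_continuous_cube[OF continuous_cos_basis])
    moreover have "((\<lambda>m. v m * (\<integral>x. cos_basis k x * cos_basis m x \<partial>cube_measure))
        has_sum v k * (1 / 2 ^ card {i. k $ i \<noteq> 0})) UNIV"
    proof -
      have "((\<lambda>m. v m * (\<integral>x. cos_basis k x * cos_basis m x \<partial>cube_measure))
        has_sum (\<Sum>m\<in>{k}. v m * (\<integral>x. cos_basis k x * cos_basis m x \<partial>cube_measure))) UNIV"
        by (rule has_sum_finite_neutralI[where B="{k}"]) (auto simp: cos_basis_orthogonal)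
      then show ?thesis by (simp add: cos_basis_orthogonal)
    qed
    ultimately have "(\<integral>x. U x * cos_basis k x \<partial>cube_measure) = v k * (1 / 2 ^ card {i. k $ i \<noteq> 0})"
      by (rule has_sum_unique)
    also have "\<dots> = (\<integral>x. V x * cos_basis k x \<partial>cube_measure)"
      by (simp add: v_def cosine_coefficient_def)
    finally show "(\<integral>x. (V x - U x) * cos_basis k x \<partial>cube_measure) = 0"
      using integrable_mult_continuous[OF V continuous_cos_basis]
        integrable_mult_continuous[OF integrable_continuous_cube[OF contU] continuous_cos_basis]
      by (simp add: left_diff_distrib)
  qed
  then have VU: "AE x in cube_measure. V x = U x" by simp
  obtain B where B: "\<And>x. x \<in> unit_cube \<Longrightarrow> \<bar>U x\<bar> \<le> B"
    using continuous_bounded_cube[OF contU] by blast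
  have "AE x in cube_measure. \<bar>V x\<bar> \<le> B"
    using VU AE_space by eventually_elim (simp add: B)
  then show "\<exists>B. AE x in cube_measure. \<bar>V x\<bar> \<le> B" by (rule exI[of _ B])
  fix h :: "real^'n \<Rightarrow> real" assume h: "integrable cube_measure h"
  have "(\<integral>x. V x * h x \<partial>cube_measure) = (\<integral>x. U x * h x \<partial>cube_measure)"
  proof (rule integral_cong_AE)
    show "(\<lambda>x. V x * h x) \<in> borel_measurable cube_measure"
      using V h by (intro borel_measurable_times borel_measurable_integrable)
    show "(\<lambda>x. U x * h x) \<in> borel_measurable cube_measure"
      using h by (intro borel_measurable_times borel_measurable_integrable continuous_measurable_cube contU)
    show "AE x in cube_measure. V x * h x = U x * h x" using VU by eventually_elim simp
  qed
  then show "((\<lambda>m. cosine_coefficient V m * (\<integral>x. h x * cos_basis m x \<partial>cube_measure))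
        has_sum (\<integral>x. V x * h x \<partial>cube_measure)) UNIV"
    using hs[OF h] by (simp add: v_def)
qed

section \<open>Smooth functions of one variable and cutoffs\<close>

primrec times_differentiable :: "nat \<Rightarrow> (real \<Rightarrow> real) \<Rightarrow> bool" where
  "times_differentiable 0 f \<longleftrightarrow> (\<forall>x. f differentiable at x)"
| "times_differentiable (Suc n) f \<longleftrightarrow> (\<forall>x. f differentiable at x) \<and> times_differentiable n (deriv f)"

definition smooth :: "(real \<Rightarrow> real) \<Rightarrow> bool" where
  "smooth f \<longleftrightarrow> (\<forall>n. times_differentiable n f)"

lemma smooth_differentiable: "smooth f \<Longrightarrow> f differentiable at x"
  unfolding smooth_def by (metis times_differentiable.simps(1))

lemma smooth_DERIV: "smooth f \<Longrightarrow> (f has_real_derivative deriv f x) (at x)"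
  using smooth_differentiable DERIV_deriv_iff_real_differentiable by blast

lemma smooth_deriv: "smooth f \<Longrightarrow> smooth (deriv f)"
  unfolding smooth_def by (metis times_differentiable.simps(2))

text \<open>To show smoothness it suffices to exhibit a family of functions closed under differentiation. For
products, rescalings, sines and flat functions the family is a small explicit one.\<close>

lemma smooth_coinduct:
  assumes "f \<in> A" "\<And>f. f \<in> A \<Longrightarrow> \<exists>f'\<in>A. \<forall>x. (f has_real_derivative f' x) (at x)"
  shows "smooth f"
proof -
  have "\<forall>f\<in>A. times_differentiable n f" for n
  proof (induction n)
    case 0
    then show ?case using assms(2) real_differentiable_def by fastforce
  next
    case (Suc n)
    show ?case
    proof
      fix f assume "f \<in> A"
      then obtain f' where f': "f' \<in> A" "\<And>x. (f has_real_derivative f' x) (at x)"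
        using assms(2) by blast
      then have "deriv f = f'" using DERIV_imp_deriv by blast
      then show "times_differentiable (Suc n) f"
        using f' Suc real_differentiable_def by auto
    qed
  qed
  then show ?thesis using assms(1) by (auto simp: smooth_def)
qed

lemma smooth_mult:
  assumes "smooth f" "smooth g"
  shows "smooth (\<lambda>x. f x * g x)"
proof -
  define A where "A = {h :: real \<Rightarrow> real. \<exists>I F G. finite (I :: nat set) \<and>
     (\<forall>i\<in>I. smooth (F i) \<and> smooth (G i)) \<and> h = (\<lambda>x. \<Sum>i\<in>I. F i x * G i x)}"
  show ?thesis
  proof (rule smooth_coinduct)
    show "(\<lambda>x. f x * g x) \<in> A" unfolding A_def
      by (rule CollectI, rule exI[of _ "{0}"], rule exI[of _ "\<lambda>_. f"], rule exI[of _ "\<lambda>_. g"])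
         (use assms in auto)
    fix h assume "h \<in> A"
    then obtain I F G where I: "finite (I :: nat set)" "\<And>i. i \<in> I \<Longrightarrow> smooth (F i) \<and> smooth (G i)"
      and h: "h = (\<lambda>x. \<Sum>i\<in>I. F i x * G i x)" unfolding A_def by blast
    \<comment> \<open>The derivative of each summand \<open>F G\<close> is \<open>F' G + F G'\<close>; the two new summands get the indices \<open>2 i\<close> and \<open>2 i + 1\<close>.\<close>
    define J where "J = (\<lambda>i. 2 * i) ` I \<union> (\<lambda>i. 2 * i + 1) ` I"
    define F' where "F' j = (if even j then deriv (F (j div 2)) else F (j div 2))" for j
    define G' where "G' j = (if even j then G (j div 2) else deriv (G (j div 2)))" for j
    have "(\<lambda>i. 2 * i) ` I \<inter> (\<lambda>i. 2 * i + 1) ` I = {}" by auto presburger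
    then have sum: "(\<Sum>j\<in>J. F' j x * G' j x)
        = (\<Sum>i\<in>I. deriv (F i) x * G i x) + (\<Sum>i\<in>I. F i x * deriv (G i) x)" for x
      unfolding J_def using I(1)
      by (subst sum.union_disjoint) (auto simp: sum.reindex inj_on_def F'_def G'_def)
    show "\<exists>h'\<in>A. \<forall>x. (h has_real_derivative h' x) (at x)"
    proof (rule bexI[of _ "\<lambda>x. \<Sum>j\<in>J. F' j x * G' j x"])
      show "\<forall>x. (h has_real_derivative (\<Sum>j\<in>J. F' j x * G' j x)) (at x)"
        unfolding h sum sum.distrib[symmetric]
        by (auto intro!: DERIV_sum DERIV_mult' simp: I(2) smooth_DERIV add.commute mult.commute
            intro: DERIV_cong[OF DERIV_mult'[OF smooth_DERIV smooth_DERIV]])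
      show "(\<lambda>x. \<Sum>j\<in>J. F' j x * G' j x) \<in> A"
        unfolding A_def
        by (rule CollectI, rule exI[of _ J], rule exI[of _ F'], rule exI[of _ G'])
           (use I in \<open>auto simp: J_def F'_def G'_def smooth_deriv\<close>)
    qed
  qed
qed

lemma smooth_affine:
  assumes "smooth f"
  shows "smooth (\<lambda>x. f (a * x + b))"
proof (rule smooth_coinduct[where A="{\<lambda>x. c * f (a * x + b) | c f. smooth f}"])
  show "(\<lambda>x. f (a * x + b)) \<in> {\<lambda>x. c * f (a * x + b) | c f. smooth f}"
    using assms by (auto intro!: exI[of _ 1])
  fix h assume "h \<in> {\<lambda>x. c * f (a * x + b) | c f. smooth f}"
  then obtain c f where h: "h = (\<lambda>x. c * f (a * x + b))" "smooth f" by blast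
  have "(h has_real_derivative (c * a) * deriv f (a * x + b)) (at x)" for x
  proof -
    have "((\<lambda>x. f (a * x + b)) has_real_derivative deriv f (a * x + b) * a) (at x)"
      by (rule DERIV_chain2[OF smooth_DERIV[OF h(2)]]) (auto intro!: derivative_eq_intros)
    then show ?thesis unfolding h(1) by (auto dest: DERIV_cmult[of _ _ _ _ c] simp: mult_ac)
  qed
  then show "\<exists>f'\<in>{\<lambda>x. c * f (a * x + b) | c f. smooth f}. \<forall>x. (h has_real_derivative f' x) (at x)"
    by (intro bexI[of _ "\<lambda>x. (c * a) * deriv f (a * x + b)"])
       (auto intro: exI[of _ "c * a"] exI[of _ "deriv f"] smooth_deriv h(2))
qed

lemma smooth_sin: "smooth (\<lambda>x. sin (a * x))" and smooth_cos: "smooth (\<lambda>x. cos (a * x))"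
proof -
  define A where "A = range (\<lambda>p x. fst p * sin (a * x) + snd p * cos (a * x))"
  have mem: "(\<lambda>x. c * sin (a * x) + d * cos (a * x)) \<in> A" for c d
    unfolding A_def by (rule range_eqI[of _ _ "(c, d)"]) simp
  have cl: "\<exists>f'\<in>A. \<forall>x. (f has_real_derivative f' x) (at x)" if fA: "f \<in> A" for f
  proof -
    obtain p where f: "f = (\<lambda>x. fst p * sin (a * x) + snd p * cos (a * x))"
      using fA unfolding A_def by (rule rangeE)
    have "\<forall>x. (f has_real_derivative (- snd p * a) * sin (a * x) + (fst p * a) * cos (a * x)) (at x)"
      unfolding f by (auto intro!: derivative_eq_intros)
    then show ?thesis
      using mem[of "- snd p * a" "fst p * a"]
      by (intro bexI[of _ "\<lambda>x. (- snd p * a) * sin (a * x) + (fst p * a) * cos (a * x)"])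
  qed
  show "smooth (\<lambda>x. sin (a * x))" "smooth (\<lambda>x. cos (a * x))"
    using smooth_coinduct[OF mem[of 1 0] cl] smooth_coinduct[OF mem[of 0 1] cl] by simp_all
qed

text \<open>The classical flat function \<open>exp (- 1/t)\<close>, extended by \<open>0\<close> to \<open>t \<le> 0\<close>. The polynomial factor in \<open>1/t\<close> makes
the family closed under differentiation.\<close>

definition flat_exp :: "real poly \<Rightarrow> real \<Rightarrow> real" where
  "flat_exp q t = (if t > 0 then poly q (1 / t) * exp (- (1 / t)) else 0)"

lemma poly_exp_tendsto_0: "((\<lambda>y::real. poly (q :: real poly) y * exp (- y)) \<longlongrightarrow> 0) at_top"
proof -
  have "((\<lambda>y. \<Sum>i\<le>degree q. coeff q i * (y ^ i / exp y)) \<longlongrightarrow> (\<Sum>i\<le>degree q. coeff q i * 0)) at_top"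
    by (intro tendsto_intros tendsto_power_div_exp_0)
  then show ?thesis
    by (simp add: poly_altdef exp_minus sum_distrib_right divide_inverse mult.assoc)
qed

lemma flat_exp_tendsto_0: "((\<lambda>t. poly q (1 / t) * exp (- (1 / t :: real))) \<longlongrightarrow> 0) (at_right 0)"
  using filterlim_compose[OF poly_exp_tendsto_0[of q] filterlim_inverse_at_top_right]
  unfolding inverse_eq_divide .

lemma flat_exp_DERIV:
  "(flat_exp q has_real_derivative flat_exp ([:0, 0, 1:] * (q - pderiv q)) t) (at t)"
proof -
  consider "t > 0" | "t < 0" | "t = 0" by linarith
  then show ?thesis
  proof cases
    case 1
    have "((\<lambda>t. poly q (1 / t) * exp (- (1 / t))) has_real_derivative
        poly ([:0, 0, 1:] * (q - pderiv q)) (1 / t) * exp (- (1 / t))) (at t)"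
      using 1 by (auto intro!: derivative_eq_intros DERIV_chain2[OF poly_DERIV]
          simp: field_simps power2_eq_square)
    then have "(flat_exp q has_real_derivative
        poly ([:0, 0, 1:] * (q - pderiv q)) (1 / t) * exp (- (1 / t))) (at t)"
      by (rule has_field_derivative_transform_within_open[where S="{0<..}"])
         (use 1 in \<open>auto simp: flat_exp_def\<close>)
    then show ?thesis using 1 by (simp add: flat_exp_def)
  next
    case 2
    have "((\<lambda>t. 0) has_real_derivative 0) (at t)" by simp
    then have "(flat_exp q has_real_derivative 0) (at t)"
      by (rule has_field_derivative_transform_within_open[where S="{..<0}"])
         (use 2 in \<open>auto simp: flat_exp_def\<close>)
    then show ?thesis using 2 by (simp add: flat_exp_def)
  next
    case 3
    have "((\<lambda>h. flat_exp q h / h) \<longlongrightarrow> 0) (at_right 0)"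
      using flat_exp_tendsto_0[of "[:0, 1:] * q"]
      by (rule Lim_transform_eventually)
         (auto simp: eventually_at_right_field flat_exp_def intro!: exI[of _ 1])
    moreover have "((\<lambda>h. flat_exp q h / h) \<longlongrightarrow> 0) (at_left 0)"
      by (rule Lim_transform_eventually[OF tendsto_const])
         (auto simp: eventually_at_left_field flat_exp_def intro!: exI[of _ "-1"])
    ultimately have "((\<lambda>h. flat_exp q h / h) \<longlongrightarrow> 0) (at 0)"
      by (rule filterlim_split_at[rotated])
    then show ?thesis using 3 by (simp add: DERIV_def flat_exp_def)
  qed
qed

lemma smooth_flat_exp: "smooth (flat_exp q)"
  by (rule smooth_coinduct[where A="range flat_exp"]) (use flat_exp_DERIV in blast)+

lemma flat_exp_1_bounds: "0 \<le> flat_exp 1 t" "flat_exp 1 t \<le> 1"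
  by (auto simp: flat_exp_def)

text \<open>\<open>flat_exp [:0, 0, 1:]\<close> is the derivative of \<open>flat_exp 1\<close>. With \<open>t = j x - 1\<close> the factor \<open>t + 1\<close> equals
\<open>j x\<close>; so the bound says that the slope of the rescaled function at \<open>x\<close> is \<open>O(1/x)\<close>, uniformly in \<open>j\<close>.\<close>

lemma flat_exp_deriv_bounds:
  assumes "t > - 1"
  shows "0 \<le> (t + 1) * flat_exp [:0, 0, 1:] t" "(t + 1) * flat_exp [:0, 0, 1:] t \<le> 2"
proof -
  show "0 \<le> (t + 1) * flat_exp [:0, 0, 1:] t" using assms by (auto simp: flat_exp_def)
  show "(t + 1) * flat_exp [:0, 0, 1:] t \<le> 2"
  proof (cases "t > 0")
    case True
    define y where "y = 1 / t"
    have y: "y > 0" using True by (simp add: y_def)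
    have "1 + y + y\<^sup>2 / 2 \<le> exp y" using exp_lower_Taylor_quadratic[of y] y by simp
    then have "y + y\<^sup>2 \<le> 2 * exp y" using y by simp
    then have "(y + y\<^sup>2) * exp (- y) \<le> 2" by (simp add: exp_minus field_simps)
    moreover have "(t + 1) * flat_exp [:0, 0, 1:] t = (y + y\<^sup>2) * exp (- y)"
      using True by (simp add: flat_exp_def y_def field_simps power2_eq_square)
    ultimately show ?thesis by simp
  qed (simp add: flat_exp_def)
qed

lemma flat_exp_scale_tendsto:
  assumes "x > 0"
  shows "(\<lambda>j. flat_exp 1 (real j * x - 1)) \<longlonglongrightarrow> 1"
    and "(\<lambda>j. real j * flat_exp [:0, 0, 1:] (real j * x - 1)) \<longlonglongrightarrow> 0"
proof -
  define y where "y j = 1 / (real j * x - 1)" for j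
  have "filterlim (\<lambda>j. - 1 + real j * x) at_top sequentially"
    by (intro filterlim_tendsto_add_at_top[OF tendsto_const]
        filterlim_at_top_mult_tendsto_pos[OF tendsto_const assms] filterlim_real_sequentially)
  then have lim: "filterlim (\<lambda>j. real j * x - 1) at_top sequentially" by simp
  then have pos: "\<forall>\<^sub>F j in sequentially. real j * x - 1 > 0"
    unfolding filterlim_at_top_dense by blast
  have y: "y \<longlonglongrightarrow> 0"
    using tendsto_inverse_0_at_top[OF lim] by (simp add: y_def[abs_def] inverse_eq_divide)
  have "(\<lambda>j. exp (- y j)) \<longlonglongrightarrow> exp (- 0)" by (intro tendsto_intros y)
  then show "(\<lambda>j. flat_exp 1 (real j * x - 1)) \<longlonglongrightarrow> 1"
    by (rule Lim_transform_eventually[THEN tendsto_eq_rhs])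
       (use pos in \<open>auto elim!: eventually_mono simp: flat_exp_def y_def\<close>)
  have "(\<lambda>j. (1 / x) * ((y j + (y j)\<^sup>2) * exp (- y j))) \<longlonglongrightarrow> (1 / x) * ((0 + 0\<^sup>2) * exp (- 0))"
    by (intro tendsto_intros y)
  then show "(\<lambda>j. real j * flat_exp [:0, 0, 1:] (real j * x - 1)) \<longlonglongrightarrow> 0"
  proof (rule Lim_transform_eventually[THEN tendsto_eq_rhs])
    show "\<forall>\<^sub>F j in sequentially. (1 / x) * ((y j + (y j)\<^sup>2) * exp (- y j))
        = real j * flat_exp [:0, 0, 1:] (real j * x - 1)"
      using pos
    proof eventually_elim
      case (elim j)
      have "(1 / x) * (y j + (y j)\<^sup>2) = real j * (y j)\<^sup>2"
        using elim assms by (simp add: y_def divide_simps power2_eq_square)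
      then have "(1 / x) * ((y j + (y j)\<^sup>2) * exp (- y j)) = real j * ((y j)\<^sup>2 * exp (- y j))"
        by (simp only: mult.assoc[symmetric])
      then show ?case using elim by (simp add: flat_exp_def y_def power2_eq_square)
    qed
  qed simp
qed

text \<open>These cutoffs have no plateau where they equal \<open>1\<close>; they only converge to \<open>1\<close> pointwise. Together
with \<open>sin_mult_deriv_cutoff_bounded\<close> this suffices for dominated convergence.\<close>

definition cutoff :: "nat \<Rightarrow> real \<Rightarrow> real" where
  "cutoff j x = flat_exp 1 (real j * x - 1) * flat_exp 1 (real j * (1 - x) - 1)"

lemma cutoff_smooth: "smooth (cutoff j)"
  using smooth_mult[OF smooth_affine[OF smooth_flat_exp[of 1], of "real j" "- 1"]
      smooth_affine[OF smooth_flat_exp[of 1], of "- real j" "real j - 1"]]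
  by (simp add: cutoff_def[abs_def] algebra_simps)

lemma cutoff_bounds: "0 \<le> cutoff j x" "cutoff j x \<le> 1"
  unfolding cutoff_def using flat_exp_1_bounds by (auto intro: mult_le_one)

lemma deriv_cutoff:
  "deriv (cutoff j) x = real j * flat_exp [:0, 0, 1:] (real j * x - 1) * flat_exp 1 (real j * (1 - x) - 1)
     - real j * flat_exp [:0, 0, 1:] (real j * (1 - x) - 1) * flat_exp 1 (real j * x - 1)"
proof (rule DERIV_imp_deriv)
  have D: "(flat_exp 1 has_real_derivative flat_exp [:0, 0, 1:] t) (at t)" for t
    using flat_exp_DERIV[of 1 t] by (simp add: pderiv_1)
  show "(cutoff j has_real_derivative
      real j * flat_exp [:0, 0, 1:] (real j * x - 1) * flat_exp 1 (real j * (1 - x) - 1)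
     - real j * flat_exp [:0, 0, 1:] (real j * (1 - x) - 1) * flat_exp 1 (real j * x - 1)) (at x)"
    unfolding cutoff_def[abs_def]
    by (auto intro!: derivative_eq_intros DERIV_chain2[OF D])
qed

lemma cutoff_eq_0: "x \<le> 1 / real (Suc j) \<or> x \<ge> 1 - 1 / real (Suc j) \<Longrightarrow> cutoff (Suc j) x = 0"
  by (auto simp: cutoff_def flat_exp_def field_simps)

lemma cutoff_tendsto:
  assumes "0 < x" "x < 1"
  shows "(\<lambda>j. cutoff j x) \<longlonglongrightarrow> 1" "(\<lambda>j. deriv (cutoff j) x) \<longlonglongrightarrow> 0"
proof -
  have x': "1 - x > 0" using assms by simp
  note * = flat_exp_scale_tendsto[OF assms(1)] flat_exp_scale_tendsto[OF x']
  show "(\<lambda>j. cutoff j x) \<longlonglongrightarrow> 1"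
    unfolding cutoff_def using tendsto_mult[OF *(1) *(3)] by simp
  show "(\<lambda>j. deriv (cutoff j) x) \<longlonglongrightarrow> 0"
    unfolding deriv_cutoff
    using tendsto_diff[OF tendsto_mult[OF *(2) *(3)] tendsto_mult[OF *(4) *(1)]] by simp
qed

text \<open>The derivative of the cutoff is of size \<open>1/x\<close> near \<open>0\<close> and \<open>1/(1 - x)\<close> near \<open>1\<close>. The sine vanishes at both
ends and is at most \<open>\<pi> k x\<close> and \<open>\<pi> k (1 - x)\<close>, which compensates.\<close>

lemma sin_mult_deriv_cutoff_bounded:
  assumes "0 < x" "x < 1"
  shows "\<bar>sin (pi * real k * x) * deriv (cutoff j) x\<bar> \<le> 4 * pi * real k"
proof -
  define s where "s = \<bar>sin (pi * real k * x)\<bar>"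
  have s1: "s \<le> pi * real k * x"
    using abs_sin_x_le_abs_x[of "pi * real k * x"] assms by (simp add: s_def abs_mult)
  have "\<bar>sin (pi * real k * (1 - x))\<bar> = s"
    unfolding s_def by (simp add: right_diff_distrib sin_diff abs_mult)
  then have s2: "s \<le> pi * real k * (1 - x)"
    using abs_sin_x_le_abs_x[of "pi * real k * (1 - x)"] assms by (simp add: abs_mult)
  have key: "s * (real j * flat_exp [:0, 0, 1:] (real j * z - 1)) * flat_exp 1 w \<le> 2 * (pi * real k)"
       "0 \<le> s * (real j * flat_exp [:0, 0, 1:] (real j * z - 1)) * flat_exp 1 w"
    if z: "0 < z" "s \<le> pi * real k * z" for z w
  proof -
    define f where "f = flat_exp [:0, 0, 1:] (real j * z - 1)"
    have f0: "f \<ge> 0" by (auto simp: f_def flat_exp_def)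
    have "real j * z * f \<le> 2"
    proof (cases "j = 0")
      case False
      then show ?thesis using flat_exp_deriv_bounds(2)[of "real j * z - 1"] z by (simp add: f_def)
    qed simp
    then have "pi * real k * (real j * z * f) \<le> pi * real k * 2" by (intro mult_left_mono) auto
    moreover have "s * (real j * f) \<le> pi * real k * z * (real j * f)"
      using z f0 by (intro mult_right_mono) auto
    moreover have "pi * real k * z * (real j * f) = pi * real k * (real j * z * f)" by simp
    ultimately have le: "s * (real j * f) \<le> 2 * (pi * real k)" by linarith
    have s0: "0 \<le> s * (real j * f)" using f0 by (simp add: s_def)
    show "s * (real j * flat_exp [:0, 0, 1:] (real j * z - 1)) * flat_exp 1 w \<le> 2 * (pi * real k)"
      using mult_left_le[OF flat_exp_1_bounds(2)[of w] s0] le by (simp add: f_def)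
    show "0 \<le> s * (real j * flat_exp [:0, 0, 1:] (real j * z - 1)) * flat_exp 1 w"
      using s0 flat_exp_1_bounds(1)[of w] by (simp add: f_def)
  qed
  have "\<bar>sin (pi * real k * x) * deriv (cutoff j) x\<bar> = \<bar>s * deriv (cutoff j) x\<bar>"
    by (simp add: s_def abs_mult)
  also have "s * deriv (cutoff j) x
    = s * (real j * flat_exp [:0, 0, 1:] (real j * x - 1)) * flat_exp 1 (real j * (1 - x) - 1)
    - s * (real j * flat_exp [:0, 0, 1:] (real j * (1 - x) - 1)) * flat_exp 1 (real j * x - 1)"
    unfolding deriv_cutoff by (simp add: algebra_simps)
  also have "\<bar>\<dots>\<bar> \<le> 2 * (pi * real k) + 2 * (pi * real k)"
    using key[of x "real j * (1 - x) - 1"] key[of "1 - x" "real j * x - 1"] s1 s2 assms by linarith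
  finally show ?thesis by simp
qed

section \<open>Tensor products as test functions\<close>

definition tensor :: "('n::finite \<Rightarrow> real \<Rightarrow> real) \<Rightarrow> real^'n \<Rightarrow> real" where
  "tensor F x = (\<Prod>i\<in>UNIV. F i (x $ i))"

lemma tensor_has_derivative:
  assumes "\<And>i. smooth (F i)"
  shows "(tensor F has_derivative
     (\<lambda>h. \<Sum>i\<in>UNIV. deriv (F i) (x $ i) * (h $ i) * (\<Prod>j\<in>UNIV - {i}. F j (x $ j)))) (at x)"
proof -
  have "((\<lambda>x. F i (x $ i)) has_derivative (\<lambda>h. deriv (F i) (x $ i) * (h $ i))) (at x)" for i
  proof -
    have "((\<lambda>x. x $ i) has_derivative (\<lambda>h. h $ i)) (at x)"
      by (rule bounded_linear_imp_has_derivative) (rule bounded_linear_vec_nth)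
    then show ?thesis
      using has_derivative_compose smooth_DERIV[OF assms] unfolding has_field_derivative_def by fast
  qed
  then show ?thesis unfolding tensor_def[abs_def]
    by (rule has_derivative_prod)
qed

lemma tensor_differentiable:
  assumes "\<And>i. smooth (F i)"
  shows "tensor F differentiable (at x)"
  unfolding differentiable_def by (rule exI) (rule tensor_has_derivative[OF assms])

text \<open>A partial derivative of a product of functions of one variable is again such a product. This single
identity yields smoothness of all orders.\<close>

lemma partial_derivative_tensor:
  assumes "\<And>i. smooth (F i)"
  shows "partial_derivative i (tensor F) = tensor (F(i := deriv (F i)))"
proof
  fix x
  have "partial_derivative i (tensor F) x
    = (\<Sum>j\<in>UNIV. deriv (F j) (x $ j) * (axis i 1 $ j) * (\<Prod>l\<in>UNIV - {j}. F l (x $ l)))"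
    unfolding partial_derivative_def frechet_derivative_at[OF tensor_has_derivative[OF assms], symmetric] ..
  also have "\<dots> = (\<Sum>j\<in>UNIV. if j = i then deriv (F i) (x $ i) * (\<Prod>l\<in>UNIV - {i}. F l (x $ l)) else 0)"
    by (rule sum.cong) (auto simp: axis_def)
  also have "\<dots> = tensor (F(i := deriv (F i))) x"
    unfolding tensor_def by (simp add: prod.remove[of UNIV i])
  finally show "partial_derivative i (tensor F) x = tensor (F(i := deriv (F i))) x" .
qed

lemma tensor_continuously_differentiable:
  assumes "\<And>i. smooth (F i)"
  shows "continuously_differentiable m (tensor F)"
  using assms
proof (induction m arbitrary: F)
  case 0
  then have "tensor F differentiable_on UNIV"
    by (simp add: differentiable_on_def tensor_differentiable)
  then show ?case by (simp add: differentiable_imp_continuous_on)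
next
  case (Suc m)
  have "continuously_differentiable m (tensor (F(i := deriv (F i))))" for i
    by (rule Suc.IH) (simp add: Suc.prems smooth_deriv)
  then show ?case using Suc.prems
    by (simp add: differentiable_on_def tensor_differentiable partial_derivative_tensor)
qed

lemma tensor_cutoff_test_function:
  assumes "\<And>i. smooth (F i)"
  shows "tensor (\<lambda>i x. F i x * cutoff (Suc j) x) \<in> (test_functions :: (real^'n \<Rightarrow> real) set)"
proof -
  define a where "a = 1 / real (Suc (Suc j))"
  define K where "K = (cbox (\<chi> i. a) (\<chi> i. 1 - a) :: (real^'n) set)"
  let ?\<phi> = "tensor (\<lambda>i x. F i x * cutoff (Suc j) x) :: real^'n \<Rightarrow> real"
  have a: "0 < a" unfolding a_def by simp
  have a': "a \<le> 1 / real (Suc j)" unfolding a_def by (rule frac_le) simp_all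
  have K: "x \<in> K \<longleftrightarrow> (\<forall>i. a \<le> x $ i \<and> x $ i \<le> 1 - a)" for x
    by (simp add: K_def mem_box_cart)
  have "x \<in> unit_cube" if "x \<in> K" for x
    unfolding mem_unit_cube
  proof
    fix i
    have "a \<le> x $ i \<and> x $ i \<le> 1 - a" using that K by blast
    then show "0 < x $ i \<and> x $ i < 1" using a by linarith
  qed
  then have "K \<subseteq> unit_cube" by blast
  moreover have "?\<phi> x = 0" if xK: "x \<notin> K" for x
  proof -
    obtain i where "\<not> (a \<le> x $ i \<and> x $ i \<le> 1 - a)" using xK K by blast
    then have "x $ i \<le> 1 / real (Suc j) \<or> x $ i \<ge> 1 - 1 / real (Suc j)" using a' by linarith
    then have "cutoff (Suc j) (x $ i) = 0" by (rule cutoff_eq_0)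
    then show ?thesis unfolding tensor_def by (intro prod_zero bexI[of _ i]) simp_all
  qed
  moreover have "compact K" by (simp add: K_def)
  moreover have "continuously_differentiable m ?\<phi>" for m
    by (intro tensor_continuously_differentiable smooth_mult assms cutoff_smooth)
  ultimately show ?thesis unfolding test_functions_def by blast
qed

section \<open>Integration by parts\<close>

lemma continuously_differentiable_continuous:
  "continuously_differentiable m f \<Longrightarrow> continuous_on UNIV f"
  by (cases m) (auto intro: differentiable_imp_continuous_on)

lemma test_functionD:
  assumes "\<phi> \<in> test_functions"
  shows "\<phi> differentiable (at x)" "continuous_on UNIV \<phi>" "continuous_on UNIV (partial_derivative i \<phi>)"
proof -
  have "continuously_differentiable (Suc 0) \<phi>" using assms unfolding test_functions_def by blast
  then show "\<phi> differentiable (at x)" "continuous_on UNIV \<phi>" "continuous_on UNIV (partial_derivative i \<phi>)"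
    using continuously_differentiable_continuous[of "Suc 0" \<phi>]
    by (simp_all add: differentiable_on_def)
qed

lemma partial_derivative_DERIV:
  assumes "f differentiable (at (x + t *\<^sub>R axis i 1))"
  shows "((\<lambda>t. f (x + t *\<^sub>R axis i 1)) has_real_derivative partial_derivative i f (x + t *\<^sub>R axis i 1)) (at t)"
proof -
  let ?y = "x + t *\<^sub>R axis i 1"
  have f: "(f has_derivative frechet_derivative f (at ?y)) (at ?y)"
    by (rule iffD1[OF frechet_derivative_works assms])
  have "((\<lambda>t. x + t *\<^sub>R axis i 1) has_derivative (\<lambda>h. h *\<^sub>R axis i 1)) (at t)"
    by (auto intro!: derivative_eq_intros)
  from has_derivative_compose[OF this f]
  have "((\<lambda>t. f (x + t *\<^sub>R axis i 1)) has_derivative (\<lambda>h. frechet_derivative f (at ?y) (h *\<^sub>R axis i 1))) (at t)" .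
  moreover have "frechet_derivative f (at ?y) (h *\<^sub>R axis i 1) = partial_derivative i f ?y * h" for h
    using linear_frechet_derivative[OF assms] by (simp add: linear_scale partial_derivative_def mult.commute)
  ultimately show ?thesis by (simp add: has_field_derivative_def)
qed

lemma partial_derivative_mult:
  fixes f g :: "real^'n \<Rightarrow> real"
  assumes "f differentiable (at x)" "g differentiable (at x)"
  shows "partial_derivative i (\<lambda>x. f x * g x) x = f x * partial_derivative i g x + partial_derivative i f x * g x"
proof -
  have "((\<lambda>x. f x * g x) has_derivative
     (\<lambda>h. f x * frechet_derivative g (at x) h + frechet_derivative f (at x) h * g x)) (at x)"
    by (intro has_derivative_mult iffD1[OF frechet_derivative_works] assms)
  from frechet_derivative_at[OF this]
  show ?thesis unfolding partial_derivative_def by metis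
qed

lemma partial_derivative_outside_support:
  assumes "closed K" "\<And>x. x \<notin> K \<Longrightarrow> f x = 0" "x \<notin> K"
  shows "partial_derivative i f x = 0"
proof -
  have "((\<lambda>x. 0) has_derivative (\<lambda>h. 0 :: real)) (at x)" by simp
  then have "(f has_derivative (\<lambda>h. 0)) (at x)"
    by (rule has_derivative_transform_within_open[where s="- K"]) (use assms in auto)
  from frechet_derivative_at[OF this] show ?thesis
    unfolding partial_derivative_def by metis
qed

text \<open>By translation invariance of Lebesgue measure every difference
quotient of \<open>h\<close> in the direction of the \<open>i\<close>-th axis has integral \<open>0\<close>. The quotients converge to the
partial derivative, and by the mean value theorem they are bounded by its maximum and vanish
outside a ball.\<close>

lemma integral_partial_derivative_zero:
  fixes h :: "real^'n \<Rightarrow> real"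
  assumes diff: "\<And>x. h differentiable (at x)"
    and cont: "continuous_on UNIV (partial_derivative i h)"
    and K: "compact K" "\<And>x. x \<notin> K \<Longrightarrow> h x = 0"
  shows "(\<integral>x. partial_derivative i h x \<partial>lborel) = 0"
proof -
  let ?e = "axis i (1::real) :: real^'n"
  let ?D = "partial_derivative i h"
  have zero: "?D x = 0" if "x \<notin> K" for x
    by (rule partial_derivative_outside_support[OF compact_imp_closed[OF K(1)] K(2) that])
  have "compact (?D ` K)" using cont K by (intro compact_continuous_image) (auto intro: continuous_on_subset)
  then obtain B0 where B0: "\<forall>y\<in>?D ` K. norm y \<le> B0" using compact_imp_bounded bounded_iff by metis
  \<comment> \<open>The maximum with \<open>0\<close> covers the case of an empty support.\<close>
  define B where "B = max B0 0"
  have B: "\<bar>?D x\<bar> \<le> B" for x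
    by (cases "x \<in> K") (use B0 zero in \<open>auto simp: B_def\<close>)
  obtain R where R: "\<And>x. x \<in> K \<Longrightarrow> norm x \<le> R" using compact_imp_bounded[OF K(1)] bounded_iff by metis
  define q where "q n x = real (Suc n) * (h (x + (1 / real (Suc n)) *\<^sub>R ?e) - h x)" for n x
  have hc: "continuous_on UNIV h"
    using diff by (intro differentiable_imp_continuous_on) (simp add: differentiable_on_def)
  have hm[measurable]: "h \<in> borel_measurable borel" using hc by (rule borel_measurable_continuous_onI)
  have hint: "integrable lborel h"
  proof -
    have "integrable lborel (\<lambda>x. indicator K x *\<^sub>R h x)"
      using borel_integrable_compact[of K h] K(1) hc by (auto simp: intro: continuous_on_subset)
    moreover have "(\<lambda>x. indicator K x *\<^sub>R h x) = h"
      by (rule ext) (metis K(2) indicator_simps scaleR_one scaleR_zero_right)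
    ultimately show ?thesis by simp
  qed
  have qint: "(\<integral>x. q n x \<partial>lborel) = 0" for n
  proof -
    have tr: "has_bochner_integral lborel (\<lambda>x. h (t + x)) (integral\<^sup>L lborel h)" for t
    proof -
      have "has_bochner_integral (distr lborel borel ((+) t)) h (integral\<^sup>L lborel h)"
        using hint by (simp add: lborel_distr_plus has_bochner_integral_iff)
      then show ?thesis by (simp add: has_bochner_integral_iff integrable_distr_eq integral_distr)
    qed
    show ?thesis unfolding q_def
      using tr[of "(1 / real (Suc n)) *\<^sub>R ?e"] hint
      by (simp add: has_bochner_integral_iff add.commute)
  qed
  have qb: "\<bar>q n x\<bar> \<le> B * indicator (cball 0 (R + 1)) x" for n x
  proof -
    define d where "d = 1 / real (Suc n)"
    have d: "0 < d" "d \<le> 1" by (auto simp: d_def)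
    obtain z where z: "0 < z" "z < d"
      "h (x + d *\<^sub>R ?e) - h (x + 0 *\<^sub>R ?e) = (d - 0) * ?D (x + z *\<^sub>R ?e)"
      using MVT2[of 0 d "\<lambda>t. h (x + t *\<^sub>R ?e)" "\<lambda>t. ?D (x + t *\<^sub>R ?e)"]
        partial_derivative_DERIV diff d by blast
    have q: "q n x = ?D (x + z *\<^sub>R ?e)"
      using z(3) d by (simp add: q_def d_def)
    show ?thesis
    proof (cases "x + z *\<^sub>R ?e \<in> K")
      case True
      have "norm x = norm ((x + z *\<^sub>R ?e) - z *\<^sub>R ?e)" by simp
      also have "\<dots> \<le> norm (x + z *\<^sub>R ?e) + norm (z *\<^sub>R ?e)" by (rule norm_triangle_ineq4)
      also have "\<dots> \<le> R + 1" using R[OF True] z d by (simp add: norm_axis_1)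
      finally show ?thesis using B by (simp add: q)
    next
      case False
      then show ?thesis using zero q by (simp add: B_def)
    qed
  qed
  have "(\<lambda>n. \<integral>x. q n x \<partial>lborel) \<longlonglongrightarrow> (\<integral>x. ?D x \<partial>lborel)"
  proof (rule integral_dominated_convergence)
    show "?D \<in> borel_measurable lborel" using cont by (simp add: borel_measurable_continuous_onI)
    show "q n \<in> borel_measurable lborel" for n unfolding q_def[abs_def] by measurable
    show "integrable lborel (\<lambda>x. B * indicator (cball (0::real^'n) (R + 1)) x)"
      using emeasure_bounded_finite[of "cball (0::real^'n) (R + 1)"] by auto
    show "AE x in lborel. (\<lambda>n. q n x) \<longlonglongrightarrow> ?D x"
    proof (rule AE_I2)
      fix x
      have "((\<lambda>t. h (x + t *\<^sub>R ?e)) has_real_derivative ?D (x + 0 *\<^sub>R ?e)) (at 0)"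
        by (rule partial_derivative_DERIV) (rule diff)
      then have "((\<lambda>t. (h (x + t *\<^sub>R ?e) - h x) / t) \<longlongrightarrow> ?D x) (at 0)"
        by (simp add: DERIV_def)
      moreover have "filterlim (\<lambda>n. 1 / real (Suc n)) (at 0) sequentially"
        by (rule filterlim_atI) (use LIMSEQ_inverse_real_of_nat in \<open>auto simp: inverse_eq_divide\<close>)
      ultimately have "(\<lambda>n. (h (x + (1 / real (Suc n)) *\<^sub>R ?e) - h x) / (1 / real (Suc n))) \<longlonglongrightarrow> ?D x"
        by (rule filterlim_compose)
      then show "(\<lambda>n. q n x) \<longlonglongrightarrow> ?D x" by (simp add: q_def mult.commute)
    qed
    show "AE x in lborel. norm (q n x) \<le> B * indicator (cball 0 (R + 1)) x" for n
      using qb by simp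
  qed
  then show ?thesis using qint by (simp add: LIMSEQ_const_iff)
qed

lemma integration_by_parts_test_function:
  fixes \<phi> f :: "real^'n \<Rightarrow> real"
  assumes \<phi>: "\<phi> \<in> test_functions"
    and f: "\<And>x. f differentiable (at x)" "continuous_on UNIV (partial_derivative i f)"
  shows "(\<integral>x. partial_derivative i \<phi> x * f x \<partial>cube_measure) = - (\<integral>x. \<phi> x * partial_derivative i f x \<partial>cube_measure)"
proof -
  obtain K where K: "compact K" "K \<subseteq> unit_cube" "\<And>x. x \<notin> K \<Longrightarrow> \<phi> x = 0"
    using \<phi> unfolding test_functions_def by blast
  have fc: "continuous_on UNIV f"
    using f(1) by (intro differentiable_imp_continuous_on) (simp add: differentiable_on_def)
  note \<phi>' = test_functionD[OF \<phi>]
  let ?h = "\<lambda>x. \<phi> x * f x"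
  have pd: "partial_derivative i ?h = (\<lambda>x. \<phi> x * partial_derivative i f x + partial_derivative i \<phi> x * f x)"
    using partial_derivative_mult \<phi>'(1) f(1) by blast
  have cont: "continuous_on UNIV (partial_derivative i ?h)"
    unfolding pd by (intro continuous_intros \<phi>' f fc)
  have "(\<integral>x. partial_derivative i ?h x \<partial>lborel) = 0"
    by (rule integral_partial_derivative_zero[OF _ cont K(1)]) (use K(3) \<phi>'(1) f(1) in auto)
  moreover have "(\<integral>x. partial_derivative i ?h x \<partial>cube_measure) = (\<integral>x. partial_derivative i ?h x \<partial>lborel)"
  proof -
    have "partial_derivative i ?h x = 0" if "x \<notin> unit_cube" for x
      by (rule partial_derivative_outside_support[OF compact_imp_closed[OF K(1)]]) (use K that in auto)
    then have "(\<lambda>x. indicator unit_cube x *\<^sub>R partial_derivative i ?h x) = partial_derivative i ?h"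
      by (intro ext) (metis indicator_simps(1) scaleR_one scaleR_zero_right)
    then have "(\<integral>x. partial_derivative i ?h x \<partial>cube_measure) = (\<integral>x. partial_derivative i ?h x \<partial>lebesgue)"
      by (subst integral_restrict_space) auto
    also have "\<dots> = (\<integral>x. partial_derivative i ?h x \<partial>lborel)"
      using cont by (intro integral_completion) (simp add: borel_measurable_continuous_onI)
    finally show ?thesis .
  qed
  ultimately have "(\<integral>x. \<phi> x * partial_derivative i f x + partial_derivative i \<phi> x * f x \<partial>cube_measure) = 0"
    unfolding pd by simp
  moreover have "integrable cube_measure (\<lambda>x. \<phi> x * partial_derivative i f x)"
     "integrable cube_measure (\<lambda>x. partial_derivative i \<phi> x * f x)"
    by (intro integrable_continuous_cube continuous_intros \<phi>' f fc)+
  ultimately show ?thesis by simp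
qed

section \<open>Square integrable functions and weak gradients\<close>

lemma L2_integrable:
  fixes f :: "real^'n \<Rightarrow> 'b::euclidean_space"
  assumes "f \<in> L2"
  shows "integrable cube_measure f"
proof (rule Bochner_Integration.integrable_bound)
  show "integrable cube_measure (\<lambda>x. 1 + (norm (f x))\<^sup>2)"
    using assms by (intro Bochner_Integration.integrable_add integrable_const_cube) (simp add: L2_def)
  show "f \<in> borel_measurable cube_measure" using assms by (simp add: L2_def)
  have "norm (f x) \<le> 1 + (norm (f x))\<^sup>2" for x
  proof -
    have "0 \<le> (norm (f x) - 1)\<^sup>2" by simp
    also have "\<dots> = (norm (f x))\<^sup>2 - 2 * norm (f x) + 1" by (simp add: power2_diff)
    finally show ?thesis using norm_ge_zero[of "f x"] by linarith
  qed
  then show "AE x in cube_measure. norm (f x) \<le> norm (1 + (norm (f x))\<^sup>2)" by simp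
qed

lemma continuous_in_L2:
  fixes f :: "real^'n \<Rightarrow> 'b::euclidean_space"
  assumes "continuous_on UNIV f"
  shows "f \<in> L2"
  unfolding L2_def using assms
  by (auto intro!: continuous_measurable_cube integrable_continuous_cube continuous_intros)

lemma L2_diff:
  fixes f g :: "real^'n \<Rightarrow> 'b::euclidean_space"
  assumes "f \<in> L2" "g \<in> L2"
  shows "(\<lambda>x. f x - g x) \<in> L2"
proof -
  have m: "f \<in> borel_measurable cube_measure" "g \<in> borel_measurable cube_measure"
    and i: "integrable cube_measure (\<lambda>x. 2 * (norm (f x))\<^sup>2 + 2 * (norm (g x))\<^sup>2)"
    using assms by (auto simp: L2_def)
  have "(norm (f x - g x))\<^sup>2 \<le> 2 * (norm (f x))\<^sup>2 + 2 * (norm (g x))\<^sup>2" for x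
  proof -
    have "(norm (f x - g x))\<^sup>2 \<le> (norm (f x) + norm (g x))\<^sup>2"
      by (intro power_mono norm_triangle_ineq4) auto
    also have "\<dots> \<le> 2 * (norm (f x))\<^sup>2 + 2 * (norm (g x))\<^sup>2"
      using zero_le_power2[of "norm (f x) - norm (g x)"] by (simp add: power2_sum power2_diff)
    finally show ?thesis .
  qed
  then have "integrable cube_measure (\<lambda>x. (norm (f x - g x))\<^sup>2)"
    by (intro Bochner_Integration.integrable_bound[OF i]) (use m in auto)
  then show ?thesis using m by (auto simp: L2_def)
qed

text \<open>This is the Cauchy-Schwarz inequality on a space of total mass \<open>1\<close>, in the form that a variance is
nonnegative.\<close>

lemma integral_norm_le_sqrt:
  fixes f :: "real^'n \<Rightarrow> 'b::euclidean_space"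
  assumes "f \<in> L2"
  shows "(\<integral>x. norm (f x) \<partial>cube_measure) \<le> sqrt (\<integral>x. (norm (f x))\<^sup>2 \<partial>cube_measure)"
proof (rule real_le_rsqrt)
  define c where "c = (\<integral>x. norm (f x) \<partial>cube_measure)"
  have i: "integrable cube_measure (\<lambda>x. norm (f x))" "integrable cube_measure (\<lambda>x. (norm (f x))\<^sup>2)"
    using assms L2_integrable[OF assms] by (auto simp: L2_def)
  have "0 \<le> (\<integral>x. (norm (f x) - c)\<^sup>2 \<partial>cube_measure)" by simp
  also have "\<dots> = (\<integral>x. ((norm (f x))\<^sup>2 - 2 * c * norm (f x)) + c\<^sup>2 \<partial>cube_measure)"
    by (simp add: power2_diff algebra_simps)
  also have "\<dots> = ((\<integral>x. (norm (f x))\<^sup>2 \<partial>cube_measure) - 2 * c * c) + c\<^sup>2"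
  proof -
    have m1: "measure cube_measure (unit_cube :: (real^'n) set) = 1"
      using prob_cube[where 'n='n] by simp
    show ?thesis
      using i integrable_const_cube[where 'n='n] by (simp add: m1 c_def[symmetric])
  qed
  finally show "c\<^sup>2 \<le> (\<integral>x. (norm (f x))\<^sup>2 \<partial>cube_measure)" by (simp add: power2_eq_square)
qed

lemma integrable_inner_bounded:
  fixes f g :: "real^'n \<Rightarrow> 'b::euclidean_space"
  assumes "integrable cube_measure f" "g \<in> borel_measurable cube_measure" "\<And>x. x \<in> unit_cube \<Longrightarrow> norm (g x) \<le> C"
  shows "integrable cube_measure (\<lambda>x. f x \<bullet> g x)"
proof (rule Bochner_Integration.integrable_bound)
  show "integrable cube_measure (\<lambda>x. C * norm (f x))" using assms(1) by auto
  show "(\<lambda>x. f x \<bullet> g x) \<in> borel_measurable cube_measure" using assms(1,2) by measurable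
  show "AE x in cube_measure. norm (f x \<bullet> g x) \<le> norm (C * norm (f x))"
  proof (rule AE_I2)
    fix x :: "real^'n" assume "x \<in> space cube_measure"
    then have "norm (g x) * norm (f x) \<le> C * norm (f x)" using assms(3) by (intro mult_right_mono) auto
    then show "norm (f x \<bullet> g x) \<le> norm (C * norm (f x))"
      using Cauchy_Schwarz_ineq2[of "f x" "g x"] by (simp add: mult.commute)
  qed
qed

lemma L2_tendsto_integral_inner:
  fixes f g :: "real^'n \<Rightarrow> 'b::euclidean_space"
  assumes "\<And>j. F j \<in> L2" "f \<in> L2"
    and lim: "(\<lambda>j. \<integral>x. (norm (F j x - f x))\<^sup>2 \<partial>cube_measure) \<longlonglongrightarrow> 0"
    and g: "g \<in> borel_measurable cube_measure" "\<And>x. x \<in> unit_cube \<Longrightarrow> norm (g x) \<le> C"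
  shows "(\<lambda>j. \<integral>x. F j x \<bullet> g x \<partial>cube_measure) \<longlonglongrightarrow> (\<integral>x. f x \<bullet> g x \<partial>cube_measure)"
proof (rule LIM_zero_cancel, rule Lim_null_comparison)
  have "(\<lambda>j. C * sqrt (\<integral>x. (norm (F j x - f x))\<^sup>2 \<partial>cube_measure)) \<longlonglongrightarrow> C * sqrt 0"
    by (intro tendsto_intros lim)
  then show "(\<lambda>j. C * sqrt (\<integral>x. (norm (F j x - f x))\<^sup>2 \<partial>cube_measure)) \<longlonglongrightarrow> 0" by simp
  have "((\<chi> i. 1/2) :: real^'n) \<in> unit_cube" by (simp add: mem_unit_cube)
  then have C: "0 \<le> C" using g(2) norm_ge_zero order_trans by blast
  show "\<forall>\<^sub>F j in sequentially. norm ((\<integral>x. F j x \<bullet> g x \<partial>cube_measure) - (\<integral>x. f x \<bullet> g x \<partial>cube_measure))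
      \<le> C * sqrt (\<integral>x. (norm (F j x - f x))\<^sup>2 \<partial>cube_measure)"
  proof (rule always_eventually, rule allI)
    fix j
    have d: "(\<lambda>x. F j x - f x) \<in> L2" by (intro L2_diff assms)
    have "(\<integral>x. F j x \<bullet> g x \<partial>cube_measure) - (\<integral>x. f x \<bullet> g x \<partial>cube_measure)
        = (\<integral>x. (F j x - f x) \<bullet> g x \<partial>cube_measure)"
      using integrable_inner_bounded[OF L2_integrable[OF assms(1)] g] integrable_inner_bounded[OF L2_integrable[OF assms(2)] g]
      by (simp add: inner_diff_left)
    also have "norm \<dots> \<le> (\<integral>x. C * norm (F j x - f x) \<partial>cube_measure)"
      unfolding real_norm_def
    proof (rule integral_abs_bound[THEN order_trans], rule integral_mono)
      show "integrable cube_measure (\<lambda>x. \<bar>(F j x - f x) \<bullet> g x\<bar>)"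
        using integrable_inner_bounded[OF L2_integrable[OF d] g] by auto
      show "integrable cube_measure (\<lambda>x. C * norm (F j x - f x))" using L2_integrable[OF d] by auto
      fix x :: "real^'n" assume "x \<in> space cube_measure"
      then have "norm (F j x - f x) * norm (g x) \<le> norm (F j x - f x) * C" using g(2) by (intro mult_left_mono) auto
      then show "\<bar>(F j x - f x) \<bullet> g x\<bar> \<le> C * norm (F j x - f x)"
        using Cauchy_Schwarz_ineq2[of "F j x - f x" "g x"] by (simp add: mult.commute)
    qed
    also have "\<dots> = C * (\<integral>x. norm (F j x - f x) \<partial>cube_measure)" by simp
    also have "\<dots> \<le> C * sqrt (\<integral>x. (norm (F j x - f x))\<^sup>2 \<partial>cube_measure)"
      by (intro mult_left_mono integral_norm_le_sqrt d C)
    finally show "norm ((\<integral>x. F j x \<bullet> g x \<partial>cube_measure) - (\<integral>x. f x \<bullet> g x \<partial>cube_measure))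
      \<le> C * sqrt (\<integral>x. (norm (F j x - f x))\<^sup>2 \<partial>cube_measure)" .
  qed
qed

lemma continuous_grad_test: "\<phi> \<in> test_functions \<Longrightarrow> continuous_on UNIV (grad \<phi>)"
  unfolding grad_def[abs_def] by (intro continuous_on_vec_lambda test_functionD)

lemma integrable_scaleR_continuous:
  fixes G :: "real^'n \<Rightarrow> real^'n"
  assumes "integrable cube_measure G" "continuous_on UNIV \<phi>"
  shows "integrable cube_measure (\<lambda>x. \<phi> x *\<^sub>R G x)"
proof -
  obtain B where B: "\<And>x. x \<in> unit_cube \<Longrightarrow> \<bar>\<phi> x\<bar> \<le> B" using continuous_bounded_cube[OF assms(2)] by blast
  show ?thesis
  proof (rule Bochner_Integration.integrable_bound)
    show "integrable cube_measure (\<lambda>x. B * norm (G x))" using assms(1) by auto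
    show "(\<lambda>x. \<phi> x *\<^sub>R G x) \<in> borel_measurable cube_measure"
      using assms continuous_measurable_cube[OF assms(2)] by (intro borel_measurable_scaleR) auto
    show "AE x in cube_measure. norm (\<phi> x *\<^sub>R G x) \<le> norm (B * norm (G x))"
      by (rule AE_I2) (auto simp: abs_mult intro!: mult_right_mono order_trans[OF B])
  qed
qed

lemma integral_nth:
  fixes f :: "real^'n \<Rightarrow> real^'n"
  assumes "integrable cube_measure f"
  shows "(\<integral>x. f x \<partial>cube_measure) $ i = (\<integral>x. f x $ i \<partial>cube_measure)"
  using integral_bounded_linear[OF bounded_linear_vec_nth assms, of i] by simp

lemma integrable_nth:
  fixes f :: "real^'n \<Rightarrow> real^'n"
  assumes "integrable cube_measure f"
  shows "integrable cube_measure (\<lambda>x. f x $ i)"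
  using integrable_bounded_linear[OF bounded_linear_vec_nth assms, of i] by simp

text \<open>Each component \<open>W\<close> of the difference is orthogonal to all test functions, in particular to the cosine
products multiplied by cutoffs. Removing the cutoffs by dominated convergence shows that all cosine
coefficients of \<open>W\<close> vanish.\<close>

lemma weak_gradient_unique:
  assumes "has_weak_gradient u G1" "has_weak_gradient u G2"
  shows "AE x in cube_measure. G1 x = (G2 x :: real^'n)"
proof -
  have G: "integrable cube_measure G1" "integrable cube_measure G2"
    using assms unfolding has_weak_gradient_def by (auto intro: L2_integrable)
  have "AE x in cube_measure. G1 x $ i - G2 x $ i = 0" for i
  proof (rule cos_coeffs_zero_imp_AE_zero)
    show W: "integrable cube_measure (\<lambda>x. G1 x $ i - G2 x $ i)" by (intro Bochner_Integration.integrable_diff integrable_nth G)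
    fix m :: "nat^'n"
    define \<phi> where "\<phi> j = tensor (\<lambda>l t. cos (pi * real (m $ l) * t) * cutoff (Suc j) t)" for j
    have test: "\<phi> j \<in> test_functions" for j
      unfolding \<phi>_def by (intro tensor_cutoff_test_function smooth_cos)
    have z: "(\<integral>x. (G1 x $ i - G2 x $ i) * \<phi> j x \<partial>cube_measure) = 0" for j
    proof -
      note int = integrable_scaleR_continuous[OF G(1) test_functionD(2)[OF test[of j]]]
        integrable_scaleR_continuous[OF G(2) test_functionD(2)[OF test[of j]]]
      have "(\<integral>x. \<phi> j x *\<^sub>R G1 x \<partial>cube_measure) = (\<integral>x. \<phi> j x *\<^sub>R G2 x \<partial>cube_measure)"
        using bspec[OF conjunct2[OF assms(1)[unfolded has_weak_gradient_def]] test[of j]]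
          bspec[OF conjunct2[OF assms(2)[unfolded has_weak_gradient_def]] test[of j]] by simp
      then have "(\<integral>x. \<phi> j x * G1 x $ i \<partial>cube_measure) = (\<integral>x. \<phi> j x * G2 x $ i \<partial>cube_measure)"
        using integral_nth[OF int(1), of i] integral_nth[OF int(2), of i] by simp
      then show ?thesis using integrable_nth[OF int(1), of i] integrable_nth[OF int(2), of i]
        by (simp add: algebra_simps)
    qed
    have "(\<lambda>j. \<integral>x. (G1 x $ i - G2 x $ i) * \<phi> j x \<partial>cube_measure) \<longlonglongrightarrow>
      (\<integral>x. (G1 x $ i - G2 x $ i) * cos_basis m x \<partial>cube_measure)"
    proof (rule integral_dominated_convergence)
      show "(\<lambda>x. (G1 x $ i - G2 x $ i) * cos_basis m x) \<in> borel_measurable cube_measure"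
        by (intro borel_measurable_integrable integrable_mult_continuous W continuous_cos_basis)
      show "(\<lambda>x. (G1 x $ i - G2 x $ i) * \<phi> j x) \<in> borel_measurable cube_measure" for j
        by (intro borel_measurable_integrable integrable_mult_continuous W test_functionD test)
      show "integrable cube_measure (\<lambda>x. \<bar>G1 x $ i - G2 x $ i\<bar>)" using W by auto
      show "AE x in cube_measure. (\<lambda>j. (G1 x $ i - G2 x $ i) * \<phi> j x) \<longlonglongrightarrow> (G1 x $ i - G2 x $ i) * cos_basis m x"
      proof (rule AE_I2)
        fix x :: "real^'n" assume "x \<in> space cube_measure"
        then have x: "0 < x $ l" "x $ l < 1" for l by (auto simp: mem_unit_cube)
        have "(\<lambda>j. \<phi> j x) \<longlonglongrightarrow> (\<Prod>l\<in>UNIV. cos (pi * real (m $ l) * x $ l) * 1)"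
          unfolding \<phi>_def tensor_def
          by (intro tendsto_intros LIMSEQ_Suc[OF cutoff_tendsto(1)] x)
        then show "(\<lambda>j. (G1 x $ i - G2 x $ i) * \<phi> j x) \<longlonglongrightarrow> (G1 x $ i - G2 x $ i) * cos_basis m x"
          unfolding cos_basis_def by (intro tendsto_intros) simp
      qed
      have "\<bar>\<phi> j x\<bar> \<le> 1" for j x
        unfolding \<phi>_def tensor_def abs_prod
        by (rule prod_le_1) (use cutoff_bounds in \<open>auto simp: abs_mult intro!: mult_le_one\<close>)
      then show "AE x in cube_measure. norm ((G1 x $ i - G2 x $ i) * \<phi> j x) \<le> \<bar>G1 x $ i - G2 x $ i\<bar>" for j
        by (simp add: abs_mult mult_left_le)
    qed
    then show "(\<integral>x. (G1 x $ i - G2 x $ i) * cos_basis m x \<partial>cube_measure) = 0"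
      using z by (simp add: LIMSEQ_const_iff)
  qed
  then have "AE x in cube_measure. \<forall>i\<in>UNIV. G1 x $ i - G2 x $ i = 0"
    by (intro AE_finite_allI) auto
  then show ?thesis by eventually_elim (auto simp: vec_eq_iff)
qed

lemma has_weak_gradient_weak_grad: "u \<in> H1 \<Longrightarrow> has_weak_gradient u (weak_grad u)"
  unfolding H1_def weak_grad_def by (auto intro: someI[where P="has_weak_gradient u"])

lemma test_function_has_weak_gradient:
  fixes \<phi> :: "real^'n \<Rightarrow> real"
  assumes "\<phi> \<in> test_functions"
  shows "has_weak_gradient \<phi> (grad \<phi>)"
  unfolding has_weak_gradient_def
proof (intro conjI ballI)
  show "grad \<phi> \<in> L2" by (intro continuous_in_L2 continuous_grad_test assms)
  fix \<psi> :: "real^'n \<Rightarrow> real" assume \<psi>: "\<psi> \<in> test_functions"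
  note c = test_functionD(2)[OF assms] test_functionD(2)[OF \<psi>]
  have i: "integrable cube_measure (\<lambda>x. \<phi> x *\<^sub>R grad \<psi> x)" "integrable cube_measure (\<lambda>x. \<psi> x *\<^sub>R grad \<phi> x)"
    by (intro integrable_scaleR_continuous c L2_integrable continuous_in_L2 continuous_grad_test assms \<psi>)+
  show "(\<integral>x. \<phi> x *\<^sub>R grad \<psi> x \<partial>cube_measure) = - (\<integral>x. \<psi> x *\<^sub>R grad \<phi> x \<partial>cube_measure)"
    unfolding vec_eq_iff vector_uminus_component
    using integration_by_parts_test_function[OF \<psi> test_functionD(1)[OF assms] test_functionD(3)[OF assms]]
    by (simp only: integral_nth[OF i(1)] integral_nth[OF i(2)]) (simp add: grad_def mult.commute)
qed

lemma test_function_in_H1: "\<phi> \<in> test_functions \<Longrightarrow> \<phi> \<in> H1"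
  unfolding H1_def by (auto intro: test_function_has_weak_gradient continuous_in_L2 test_functionD(2))

lemma weak_grad_test_function:
  assumes "\<phi> \<in> test_functions"
  shows "AE x in cube_measure. weak_grad \<phi> x = grad \<phi> x"
  by (rule weak_gradient_unique[OF has_weak_gradient_weak_grad[OF test_function_in_H1[OF assms]]
      test_function_has_weak_gradient[OF assms]])

lemma test_function_in_H1_0:
  assumes "\<phi> \<in> test_functions"
  shows "\<phi> \<in> H1_0"
proof -
  have "(\<integral>x. (norm (grad \<phi> x - weak_grad \<phi> x))\<^sup>2 \<partial>cube_measure) = 0"
    by (rule integral_eq_zero_AE) (use weak_grad_test_function[OF assms] in eventually_elim, simp)
  then show ?thesis unfolding H1_0_def
    using assms by (auto simp: test_function_in_H1 intro!: exI[of _ "\<lambda>_. \<phi>"])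
qed

section \<open>The eigenvalue equation in sine coefficients\<close>

definition frequency_sq :: "nat^'n \<Rightarrow> real" where
  "frequency_sq k = (\<Sum>i\<in>UNIV. (pi * real (k $ i))\<^sup>2)"

definition sine_factors :: "nat^'n \<Rightarrow> 'n \<Rightarrow> real \<Rightarrow> real" where
  "sine_factors k i t = sin (pi * real (k $ i) * t)"

lemma sin_basis_tensor: "sin_basis k = tensor (sine_factors k)"
  by (simp add: fun_eq_iff sin_basis_def tensor_def sine_factors_def)

lemma smooth_sine_factors: "smooth (sine_factors k i)"
  unfolding sine_factors_def[abs_def] by (rule smooth_sin)

lemma deriv_sine_factors:
  "deriv (sine_factors k i) = (\<lambda>t. pi * real (k $ i) * cos (pi * real (k $ i) * t))"
  by (rule ext, rule DERIV_imp_deriv, unfold sine_factors_def[abs_def])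
     (auto intro!: derivative_eq_intros)

lemma deriv_deriv_sine_factors:
  "deriv (deriv (sine_factors k i)) = (\<lambda>t. - (pi * real (k $ i))\<^sup>2 * sine_factors k i t)"
  unfolding deriv_sine_factors
  by (rule ext, rule DERIV_imp_deriv, unfold sine_factors_def[abs_def])
     (auto intro!: derivative_eq_intros simp: power2_eq_square)

lemma tensor_continuous: "(\<And>i. smooth (F i)) \<Longrightarrow> continuous_on UNIV (tensor F)"
  by (intro differentiable_imp_continuous_on) (simp add: differentiable_on_def tensor_differentiable)

lemma smooth_upd_deriv: "(\<And>i. smooth (F i)) \<Longrightarrow> smooth ((F(i := deriv (F i))) j)"
  by (simp add: smooth_deriv)

lemma continuous_grad_tensor:
  assumes "\<And>i. smooth (F i)"
  shows "continuous_on UNIV (grad (tensor F))"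
  unfolding grad_def[abs_def]
proof (intro continuous_on_vec_lambda)
  fix i
  have "continuous_on UNIV (tensor (F(i := deriv (F i))))"
    by (intro tensor_continuous smooth_upd_deriv assms)
  then show "continuous_on UNIV (partial_derivative i (tensor F))"
    by (simp add: partial_derivative_tensor assms)
qed

lemma tensor_upd_scale: "F i = (\<lambda>t. c * G i t) \<Longrightarrow> (\<And>l. l \<noteq> i \<Longrightarrow> F l = G l) \<Longrightarrow> tensor F x = c * tensor G x"
  unfolding tensor_def by (simp add: prod.remove[of UNIV i])

lemma partial_derivative_sin_basis_twice:
  "partial_derivative i (partial_derivative i (sin_basis k)) x = - (pi * real (k $ i))\<^sup>2 * sin_basis k x"
proof -
  have "partial_derivative i (partial_derivative i (sin_basis k)) x
      = tensor ((sine_factors k)(i := deriv (deriv (sine_factors k i)))) x"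
    unfolding sin_basis_tensor
    by (simp add: partial_derivative_tensor smooth_sine_factors smooth_upd_deriv smooth_deriv)
  also have "\<dots> = - (pi * real (k $ i))\<^sup>2 * tensor (sine_factors k) x"
    by (rule tensor_upd_scale[of _ i]) (simp_all only: deriv_deriv_sine_factors fun_upd_same fun_upd_other not_False_eq_True)
  finally show ?thesis by (simp only: sin_basis_tensor)
qed

lemma integral_grad_test_sin_basis:
  assumes "\<psi> \<in> test_functions"
  shows "(\<integral>x. grad \<psi> x \<bullet> grad (sin_basis k) x \<partial>cube_measure) = frequency_sq k * (\<integral>x. \<psi> x * sin_basis k x \<partial>cube_measure)"
proof -
  let ?D = "\<lambda>i. partial_derivative i (sin_basis k)"
  have D: "?D i = tensor ((sine_factors k)(i := deriv (sine_factors k i)))" for i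
    unfolding sin_basis_tensor by (intro partial_derivative_tensor smooth_sine_factors)
  have sm: "smooth (((sine_factors k)(i := deriv (sine_factors k i))) l)" for i l
    by (intro smooth_upd_deriv smooth_sine_factors)
  have diff: "?D i differentiable (at x)" for i x
    unfolding D by (intro tensor_differentiable sm)
  have cont: "continuous_on UNIV (?D i)" for i unfolding D by (intro tensor_continuous sm)
  have int: "integrable cube_measure (\<lambda>x. partial_derivative i \<psi> x * ?D i x)" for i
    by (intro integrable_continuous_cube continuous_on_mult test_functionD assms cont)
  have D2: "partial_derivative i (?D i) = (\<lambda>x. - (pi * real (k $ i))\<^sup>2 * sin_basis k x)" for i
    by (rule ext) (rule partial_derivative_sin_basis_twice)
  have one: "(\<integral>x. partial_derivative i \<psi> x * ?D i x \<partial>cube_measure)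
      = (pi * real (k $ i))\<^sup>2 * (\<integral>x. \<psi> x * sin_basis k x \<partial>cube_measure)" for i
  proof -
    have "(\<integral>x. partial_derivative i \<psi> x * ?D i x \<partial>cube_measure)
       = - (\<integral>x. \<psi> x * partial_derivative i (?D i) x \<partial>cube_measure)"
      by (rule integration_by_parts_test_function[OF assms diff])
         (unfold D2, intro continuous_intros continuous_sin_basis)
    also have "\<dots> = - (\<integral>x. - (pi * real (k $ i))\<^sup>2 * (\<psi> x * sin_basis k x) \<partial>cube_measure)"
      unfolding D2 by (simp add: mult.left_commute)
    finally show ?thesis by simp
  qed
  have "(\<integral>x. grad \<psi> x \<bullet> grad (sin_basis k) x \<partial>cube_measure)
      = (\<integral>x. (\<Sum>i\<in>UNIV. partial_derivative i \<psi> x * ?D i x) \<partial>cube_measure)"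
    by (simp add: inner_vec_def grad_def)
  also have "\<dots> = (\<Sum>i\<in>UNIV. (\<integral>x. partial_derivative i \<psi> x * ?D i x \<partial>cube_measure))"
    by (rule Bochner_Integration.integral_sum) (rule int)
  also have "\<dots> = frequency_sq k * (\<integral>x. \<psi> x * sin_basis k x \<partial>cube_measure)"
    unfolding one frequency_sq_def by (simp add: sum_distrib_right)
  finally show ?thesis .
qed

lemma H1_0D:
  fixes u :: "real^'n \<Rightarrow> real"
  assumes "u \<in> H1_0"
  shows "u \<in> L2" "weak_grad u \<in> L2"
proof -
  have "u \<in> H1" using assms by (simp add: H1_0_def)
  then show "u \<in> L2" "weak_grad u \<in> L2"
    using has_weak_gradient_weak_grad[of u] by (auto simp: H1_def has_weak_gradient_def)
qed

text \<open>This is the only place where the boundary condition enters. For a general \<open>u\<close> in \<open>H\<^sup>1\<close> integration by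
parts would produce a boundary term, since \<open>grad \<Phi>\<^sub>k\<close> does not vanish on the boundary; for \<open>u\<close> in
the closure of the test functions the identity passes to the limit.\<close>

lemma integral_weak_grad_sin_basis:
  fixes u :: "real^'n \<Rightarrow> real"
  assumes u: "u \<in> H1_0"
  shows "(\<integral>x. weak_grad u x \<bullet> grad (sin_basis k) x \<partial>cube_measure) = frequency_sq k * (\<integral>x. u x * sin_basis k x \<partial>cube_measure)"
proof -
  obtain \<psi> where \<psi>: "\<And>j::nat. \<psi> j \<in> test_functions"
    and lim: "(\<lambda>j. sqrt ((\<integral>x. (\<psi> j x - u x)\<^sup>2 \<partial>cube_measure) +
                (\<integral>x. (norm (grad (\<psi> j) x - weak_grad u x))\<^sup>2 \<partial>cube_measure))) \<longlonglongrightarrow> 0"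
    using u unfolding H1_0_def by blast
  define a where "a j = (\<integral>x. (norm (\<psi> j x - u x))\<^sup>2 \<partial>cube_measure)" for j
  define b where "b j = (\<integral>x. (norm (grad (\<psi> j) x - weak_grad u x))\<^sup>2 \<partial>cube_measure)" for j
  have nn: "a j \<ge> 0" "b j \<ge> 0" for j by (auto simp: a_def b_def)
  have "(\<lambda>j. (sqrt (a j + b j))\<^sup>2) \<longlonglongrightarrow> 0\<^sup>2"
    by (rule tendsto_power) (use lim in \<open>simp add: a_def b_def\<close>)
  then have ab: "(\<lambda>j. a j + b j) \<longlonglongrightarrow> 0" using nn by simp
  have a: "a \<longlonglongrightarrow> 0" by (rule tendsto_sandwich[OF _ _ tendsto_const ab]) (use nn in auto)
  have b: "b \<longlonglongrightarrow> 0" by (rule tendsto_sandwich[OF _ _ tendsto_const ab]) (use nn in auto)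
  note uL2 = H1_0D[OF u]
  have cg: "continuous_on UNIV (grad (sin_basis k) :: real^'n \<Rightarrow> real^'n)"
    unfolding sin_basis_tensor by (intro continuous_grad_tensor smooth_sine_factors)
  have "continuous_on UNIV (\<lambda>x. norm (grad (sin_basis k) x :: real^'n))"
    by (intro continuous_on_norm cg)
  from continuous_bounded_cube[OF this]
  obtain C where C: "\<And>x. x \<in> unit_cube \<Longrightarrow> norm (grad (sin_basis k) x) \<le> C" by auto
  have "(\<lambda>j. \<integral>x. grad (\<psi> j) x \<bullet> grad (sin_basis k) x \<partial>cube_measure)
      \<longlonglongrightarrow> (\<integral>x. weak_grad u x \<bullet> grad (sin_basis k) x \<partial>cube_measure)"
    by (rule L2_tendsto_integral_inner[OF _ uL2(2) _ continuous_measurable_cube[OF cg] C])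
       (use b in \<open>simp_all add: b_def[abs_def] continuous_in_L2 continuous_grad_test \<psi>\<close>)
  moreover have "(\<lambda>j. \<integral>x. \<psi> j x \<bullet> sin_basis k x \<partial>cube_measure) \<longlonglongrightarrow> (\<integral>x. u x \<bullet> sin_basis k x \<partial>cube_measure)"
    by (rule L2_tendsto_integral_inner[OF _ uL2(1) _ continuous_measurable_cube[OF continuous_sin_basis], where C=1])
       (use a in \<open>simp_all add: a_def[abs_def] continuous_in_L2 test_functionD \<psi> abs_sin_basis_le\<close>)
  then have "(\<lambda>j. frequency_sq k * (\<integral>x. \<psi> j x * sin_basis k x \<partial>cube_measure))
     \<longlonglongrightarrow> frequency_sq k * (\<integral>x. u x * sin_basis k x \<partial>cube_measure)"
    by (intro tendsto_mult_left) simp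
  ultimately show ?thesis
    unfolding integral_grad_test_sin_basis[OF \<psi>] by (rule LIMSEQ_unique)
qed

lemma eigenfunction_tested:
  assumes u: "dirichlet_eigenfunction V lam u" and \<phi>: "\<phi> \<in> test_functions"
  shows "(\<integral>x. weak_grad u x \<bullet> grad \<phi> x \<partial>cube_measure) + (\<integral>x. V x * u x * \<phi> x \<partial>cube_measure)
      = lam * (\<integral>x. u x * \<phi> x \<partial>cube_measure)"
proof -
  have u0: "u \<in> H1_0" using u by (simp add: dirichlet_eigenfunction_def)
  have m: "weak_grad u \<in> borel_measurable cube_measure" "weak_grad \<phi> \<in> borel_measurable cube_measure"
     "grad \<phi> \<in> borel_measurable cube_measure"
    using H1_0D(2)[OF u0] H1_0D(2)[OF test_function_in_H1_0[OF \<phi>]]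
      continuous_measurable_cube[OF continuous_grad_test[OF \<phi>]] by (simp_all add: L2_def)
  have "(\<integral>x. weak_grad u x \<bullet> weak_grad \<phi> x \<partial>cube_measure) = (\<integral>x. weak_grad u x \<bullet> grad \<phi> x \<partial>cube_measure)"
  proof (rule integral_cong_AE)
    show "AE x in cube_measure. weak_grad u x \<bullet> weak_grad \<phi> x = weak_grad u x \<bullet> grad \<phi> x"
      using weak_grad_test_function[OF \<phi>] by eventually_elim simp
  qed (intro borel_measurable_inner m)+
  then show ?thesis
    using u test_function_in_H1_0[OF \<phi>] by (auto simp: dirichlet_eigenfunction_def)
qed

text \<open>The equation holds for the products of \<open>\<Phi>\<^sub>k\<close> with cutoffs. Their gradients converge pointwise and stay
bounded by \<open>sin_mult_deriv_cutoff_bounded\<close>, so the equation survives the limit by dominated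
convergence.\<close>

lemma eigenfunction_tested_sin_basis:
  fixes V u :: "real^'n \<Rightarrow> real"
  assumes u: "dirichlet_eigenfunction V lam u"
    and Vu: "integrable cube_measure (\<lambda>x. V x * u x)"
  shows "(\<integral>x. weak_grad u x \<bullet> grad (sin_basis k) x \<partial>cube_measure) + (\<integral>x. V x * u x * sin_basis k x \<partial>cube_measure)
      = lam * (\<integral>x. u x * sin_basis k x \<partial>cube_measure)"
proof -
  have u0: "u \<in> H1_0" using u by (simp add: dirichlet_eigenfunction_def)
  define H where "H j i t = sine_factors k i t * cutoff (Suc j) t" for j i t
  define \<phi> where "\<phi> j = tensor (H j)" for j
  have smH: "smooth (H j i)" for j i
    unfolding H_def[abs_def] by (intro smooth_mult smooth_sine_factors cutoff_smooth)
  have test: "\<phi> j \<in> test_functions" for j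
    unfolding \<phi>_def H_def[abs_def] by (intro tensor_cutoff_test_function smooth_sine_factors)
  have dH: "deriv (H j i) t = deriv (sine_factors k i) t * cutoff (Suc j) t + sine_factors k i t * deriv (cutoff (Suc j)) t" for j i t
    unfolding H_def[abs_def]
    by (rule DERIV_imp_deriv, rule DERIV_cong[OF DERIV_mult[OF smooth_DERIV[OF smooth_sine_factors] smooth_DERIV[OF cutoff_smooth]]])
       simp
  define B where "B i = 5 * pi * real (k $ i)" for i
  have H1: "\<bar>H j i t\<bar> \<le> 1" for j i t
    using cutoff_bounds[of "Suc j" t] by (auto simp: H_def sine_factors_def abs_mult intro!: mult_le_one)
  have dHB: "\<bar>deriv (H j i) t\<bar> \<le> B i" if t: "0 < t" "t < 1" for j i t
  proof -
    have "\<bar>deriv (sine_factors k i) t * cutoff (Suc j) t\<bar> \<le> pi * real (k $ i) * 1 * 1"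
      unfolding deriv_sine_factors abs_mult
      by (intro mult_mono) (use cutoff_bounds[of "Suc j" t] in auto)
    moreover have "\<bar>sine_factors k i t * deriv (cutoff (Suc j)) t\<bar> \<le> 4 * pi * real (k $ i)"
      unfolding sine_factors_def by (rule sin_mult_deriv_cutoff_bounded[OF t])
    ultimately show ?thesis unfolding dH B_def by linarith
  qed
  have limH: "(\<lambda>j. H j i t) \<longlonglongrightarrow> sine_factors k i t" if t: "0 < t" "t < 1" for i t
    using tendsto_mult_left[OF LIMSEQ_Suc[OF cutoff_tendsto(1)[OF t]], of "sine_factors k i t"] by (simp add: H_def)
  have limdH: "(\<lambda>j. deriv (H j i) t) \<longlonglongrightarrow> deriv (sine_factors k i) t" if t: "0 < t" "t < 1" for i t
    using tendsto_add[OF tendsto_mult_left[OF LIMSEQ_Suc[OF cutoff_tendsto(1)[OF t]], of "deriv (sine_factors k i) t"]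
       tendsto_mult_left[OF LIMSEQ_Suc[OF cutoff_tendsto(2)[OF t]], of "sine_factors k i t"]]
    by (simp add: dH)
  have gr: "grad (tensor F) x = (\<chi> i. deriv (F i) (x $ i) * (\<Prod>l\<in>UNIV - {i}. F l (x $ l)))"
    if "\<And>i. smooth (F i)" for F :: "'n \<Rightarrow> real \<Rightarrow> real" and x
    unfolding grad_def
  proof (rule arg_cong[where f=vec_lambda], rule ext)
    fix i
    have "partial_derivative i (tensor F) x = tensor (F(i := deriv (F i))) x"
      by (simp add: partial_derivative_tensor that)
    then show "partial_derivative i (tensor F) x = deriv (F i) (x $ i) * (\<Prod>l\<in>UNIV - {i}. F l (x $ l))"
      unfolding tensor_def by (simp add: prod.remove[of UNIV i])
  qed
  have grB: "norm (grad (\<phi> j) x) \<le> (\<Sum>i\<in>UNIV. B i)" if x: "x \<in> unit_cube" for j x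
  proof -
    have "norm (grad (\<phi> j) x) \<le> (\<Sum>i\<in>UNIV. \<bar>grad (\<phi> j) x $ i\<bar>)" by (rule norm_le_l1_cart)
    also have "\<dots> \<le> (\<Sum>i\<in>UNIV. B i * 1)"
    proof (rule sum_mono)
      fix i
      have "\<bar>deriv (H j i) (x $ i)\<bar> \<le> B i" by (rule dHB) (use x in \<open>auto simp: mem_unit_cube\<close>)
      moreover have "\<bar>\<Prod>l\<in>UNIV - {i}. H j l (x $ l)\<bar> \<le> 1"
        unfolding abs_prod by (rule prod_le_1) (use H1 in auto)
      ultimately show "\<bar>grad (\<phi> j) x $ i\<bar> \<le> B i * 1"
        unfolding \<phi>_def gr[OF smH] by (simp only: vec_lambda_beta abs_mult) (intro mult_mono, auto simp: B_def)
    qed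
    finally show ?thesis by simp
  qed
  have grlim: "(\<lambda>j. grad (\<phi> j) x) \<longlonglongrightarrow> grad (sin_basis k) x" if x: "x \<in> unit_cube" for x
    unfolding \<phi>_def gr[OF smH] sin_basis_tensor gr[OF smooth_sine_factors]
    by (intro tendsto_vec_lambda tendsto_mult tendsto_prod limH limdH) (use x in \<open>auto simp: mem_unit_cube\<close>)
  have \<phi>lim: "(\<lambda>j. \<phi> j x) \<longlonglongrightarrow> sin_basis k x" if x: "x \<in> unit_cube" for x
    unfolding \<phi>_def sin_basis_tensor tensor_def
    by (intro tendsto_prod limH) (use x in \<open>auto simp: mem_unit_cube\<close>)
  have \<phi>1: "\<bar>\<phi> j x\<bar> \<le> 1" for j x
    unfolding \<phi>_def tensor_def abs_prod by (rule prod_le_1) (use H1 in auto)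
  have scalar: "(\<lambda>j. \<integral>x. f x * \<phi> j x \<partial>cube_measure) \<longlonglongrightarrow> (\<integral>x. f x * sin_basis k x \<partial>cube_measure)"
    if f: "integrable cube_measure f" for f
  proof (rule integral_dominated_convergence)
    show "(\<lambda>x. f x * sin_basis k x) \<in> borel_measurable cube_measure"
      by (intro borel_measurable_integrable integrable_mult_continuous f continuous_sin_basis)
    show "(\<lambda>x. f x * \<phi> j x) \<in> borel_measurable cube_measure" for j
      by (intro borel_measurable_integrable integrable_mult_continuous f test_functionD test)
    show "integrable cube_measure (\<lambda>x. \<bar>f x\<bar>)" using f by auto
    show "AE x in cube_measure. (\<lambda>j. f x * \<phi> j x) \<longlonglongrightarrow> f x * sin_basis k x"
      by (rule AE_I2) (auto intro!: tendsto_mult_left \<phi>lim)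
    show "AE x in cube_measure. norm (f x * \<phi> j x) \<le> \<bar>f x\<bar>" for j
      using \<phi>1 by (auto simp: abs_mult intro!: mult_left_le)
  qed
  have wL2: "weak_grad u \<in> L2" by (rule H1_0D[OF u0])
  have wm: "weak_grad u \<in> borel_measurable cube_measure" using wL2 by (simp add: L2_def)
  have "(\<lambda>j. \<integral>x. weak_grad u x \<bullet> grad (\<phi> j) x \<partial>cube_measure)
     \<longlonglongrightarrow> (\<integral>x. weak_grad u x \<bullet> grad (sin_basis k) x \<partial>cube_measure)"
  proof (rule integral_dominated_convergence)
    show "(\<lambda>x. weak_grad u x \<bullet> grad (sin_basis k) x) \<in> borel_measurable cube_measure"
      unfolding sin_basis_tensor
      by (intro borel_measurable_inner wm continuous_measurable_cube continuous_grad_tensor smooth_sine_factors)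
    show "(\<lambda>x. weak_grad u x \<bullet> grad (\<phi> j) x) \<in> borel_measurable cube_measure" for j
      by (intro borel_measurable_inner wm continuous_measurable_cube continuous_grad_test test)
    show "integrable cube_measure (\<lambda>x. norm (weak_grad u x) * (\<Sum>i\<in>UNIV. B i))"
      using L2_integrable[OF wL2] by auto
    show "AE x in cube_measure. (\<lambda>j. weak_grad u x \<bullet> grad (\<phi> j) x) \<longlonglongrightarrow> weak_grad u x \<bullet> grad (sin_basis k) x"
      by (rule AE_I2) (auto intro!: tendsto_inner grlim)
    show "AE x in cube_measure. norm (weak_grad u x \<bullet> grad (\<phi> j) x) \<le> norm (weak_grad u x) * (\<Sum>i\<in>UNIV. B i)" for j
    proof (rule AE_I2)
      fix x :: "real^'n" assume "x \<in> space cube_measure"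
      then have "norm (weak_grad u x) * norm (grad (\<phi> j) x) \<le> norm (weak_grad u x) * (\<Sum>i\<in>UNIV. B i)"
        by (intro mult_left_mono grB) auto
      then show "norm (weak_grad u x \<bullet> grad (\<phi> j) x) \<le> norm (weak_grad u x) * (\<Sum>i\<in>UNIV. B i)"
        using Cauchy_Schwarz_ineq2[of "weak_grad u x" "grad (\<phi> j) x"] by simp
    qed
  qed
  from tendsto_add[OF this scalar[OF Vu]]
  have "(\<lambda>j. lam * (\<integral>x. u x * \<phi> j x \<partial>cube_measure)) \<longlonglongrightarrow>
     (\<integral>x. weak_grad u x \<bullet> grad (sin_basis k) x \<partial>cube_measure) + (\<integral>x. V x * u x * sin_basis k x \<partial>cube_measure)"
    unfolding eigenfunction_tested[OF u test] .
  moreover have "(\<lambda>j. lam * (\<integral>x. u x * \<phi> j x \<partial>cube_measure)) \<longlonglongrightarrow> lam * (\<integral>x. u x * sin_basis k x \<partial>cube_measure)"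
    by (intro tendsto_mult_left scalar L2_integrable H1_0D[OF u0])
  ultimately show ?thesis by (rule LIMSEQ_unique)
qed

lemma eigenfunction_fourier_equation:
  fixes V u :: "real^'n \<Rightarrow> real"
  assumes u: "dirichlet_eigenfunction V lam u"
    and Vu: "integrable cube_measure (\<lambda>x. V x * u x)"
  shows "(frequency_sq k - lam) * (\<integral>x. u x * sin_basis k x \<partial>cube_measure) = - (\<integral>x. V x * (u x * sin_basis k x) \<partial>cube_measure)"
proof -
  have "u \<in> H1_0" using u by (simp add: dirichlet_eigenfunction_def)
  from eigenfunction_tested_sin_basis[OF assms, of k] show ?thesis
    unfolding integral_weak_grad_sin_basis[OF \<open>u \<in> H1_0\<close>] by (simp add: left_diff_distrib mult.assoc)
qed

section \<open>Convolution with the cosine coefficients\<close>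

text \<open>The frequency \<open>k \<plusminus> m\<close> with sign \<open>+\<close> on \<open>X\<close> and \<open>-\<close> off \<open>X\<close>, reflected back to nonnegative coordinates. The
reflection only changes the sign of the sine product.\<close>

definition shift :: "'n set \<Rightarrow> nat^'n \<Rightarrow> nat^'n \<Rightarrow> nat^'n" where
  "shift X m k = (\<chi> i. if i \<in> X then k $ i + m $ i else if m $ i \<le> k $ i then k $ i - m $ i else m $ i - k $ i)"

lemma sin_basis_times_cos_basis:
  fixes k m :: "nat^'n"
  shows "sin_basis k x * cos_basis m x
     = (1 / 2 ^ CARD('n)) * (\<Sum>X\<in>UNIV. (\<Prod>i\<in>UNIV - X. if m $ i \<le> k $ i then 1 else - 1) * sin_basis (shift X m k) x)"
proof -
  define f where "f i = sin (pi * real (k $ i + m $ i) * x $ i)" for i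
  define sg where "sg i = (if m $ i \<le> k $ i then 1 else - 1 :: real)" for i
  define g where "g i = sin (pi * real (if m $ i \<le> k $ i then k $ i - m $ i else m $ i - k $ i) * x $ i)" for i
  have factor: "sin (pi * real (k $ i) * x $ i) * cos (pi * real (m $ i) * x $ i) = (f i + sg i * g i) / 2" for i
  proof (cases "m $ i \<le> k $ i")
    case True
    then show ?thesis
      using sin_times_cos[of "pi * real (k $ i) * x $ i" "pi * real (m $ i) * x $ i"]
      by (simp add: f_def sg_def g_def of_nat_diff algebra_simps)
  next
    case False
    have "sin (pi * real (m $ i - k $ i) * x $ i) = - sin (pi * real (k $ i) * x $ i - pi * real (m $ i) * x $ i)"
      using False by (subst sin_minus[symmetric]) (simp add: of_nat_diff algebra_simps)
    then show ?thesis
      using sin_times_cos[of "pi * real (k $ i) * x $ i" "pi * real (m $ i) * x $ i"] False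
      by (simp add: f_def sg_def g_def algebra_simps)
  qed
  have "sin_basis k x * cos_basis m x = (\<Prod>i\<in>UNIV. (f i + sg i * g i) / 2)"
    unfolding sin_basis_def cos_basis_def prod.distrib[symmetric] factor ..
  also have "\<dots> = (1 / 2 ^ CARD('n)) * (\<Prod>i\<in>UNIV. f i + sg i * g i)"
    by (simp add: prod_dividef)
  also have "(\<Prod>i\<in>UNIV. f i + sg i * g i) = (\<Sum>X\<in>UNIV. (\<Prod>i\<in>X. f i) * (\<Prod>i\<in>UNIV - X. sg i * g i))"
    by (subst prod_add) simp_all
  also have "\<dots> = (\<Sum>X\<in>UNIV. (\<Prod>i\<in>UNIV - X. sg i) * sin_basis (shift X m k) x)"
  proof (rule sum.cong[OF refl])
    fix X :: "'n set"
    have "sin_basis (shift X m k) x = (\<Prod>i\<in>UNIV. if i \<in> X then f i else g i)"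
      unfolding sin_basis_def shift_def f_def g_def by (intro prod.cong) auto
    also have "\<dots> = (\<Prod>i\<in>UNIV - X. if i \<in> X then f i else g i) * (\<Prod>i\<in>X. if i \<in> X then f i else g i)"
      by (rule prod.subset_diff) auto
    also have "\<dots> = (\<Prod>i\<in>UNIV - X. g i) * (\<Prod>i\<in>X. f i)"
      by (intro arg_cong2[where f="(*)"] prod.cong) auto
    finally show "(\<Prod>i\<in>X. f i) * (\<Prod>i\<in>UNIV - X. sg i * g i) = (\<Prod>i\<in>UNIV - X. sg i) * sin_basis (shift X m k) x"
      by (simp add: prod.distrib)
  qed
  finally show ?thesis unfolding sg_def .
qed

lemma abs_integral_sin_cos_le:
  fixes u :: "real^'n \<Rightarrow> real"
  assumes u: "integrable cube_measure u"
  shows "\<bar>\<integral>x. (u x * sin_basis k x) * cos_basis m x \<partial>cube_measure\<bar>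
     \<le> (1 / 2 ^ CARD('n)) * (\<Sum>X\<in>UNIV. \<bar>\<integral>x. u x * sin_basis (shift X m k) x \<partial>cube_measure\<bar>)"
proof -
  define e where "e X = (\<Prod>i\<in>UNIV - X. if m $ i \<le> k $ i then 1 else - 1 :: real)" for X
  have e: "\<bar>e X\<bar> = 1" for X unfolding e_def abs_prod by (rule prod.neutral) auto
  have "(\<integral>x. (u x * sin_basis k x) * cos_basis m x \<partial>cube_measure)
      = (\<integral>x. (\<Sum>X\<in>UNIV. (1 / 2 ^ CARD('n)) * e X * (u x * sin_basis (shift X m k) x)) \<partial>cube_measure)"
    unfolding mult.assoc sin_basis_times_cos_basis e_def
    by (simp add: sum_distrib_left mult_ac)
  also have "\<dots> = (\<Sum>X\<in>UNIV. (\<integral>x. (1 / 2 ^ CARD('n)) * e X * (u x * sin_basis (shift X m k) x) \<partial>cube_measure))"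
    by (rule Bochner_Integration.integral_sum)
       (intro integrable_mult_right integrable_mult_continuous u continuous_sin_basis)
  also have "\<bar>\<dots>\<bar> \<le> (\<Sum>X\<in>UNIV. \<bar>\<integral>x. (1 / 2 ^ CARD('n)) * e X * (u x * sin_basis (shift X m k) x) \<partial>cube_measure\<bar>)"
    by (rule sum_abs)
  also have "\<dots> = (1 / 2 ^ CARD('n)) * (\<Sum>X\<in>UNIV. \<bar>\<integral>x. u x * sin_basis (shift X m k) x \<partial>cube_measure\<bar>)"
    by (simp add: abs_mult e sum_distrib_left)
  finally show ?thesis .
qed

text \<open>The absolute value in \<open>shift\<close> makes it non-injective, but it becomes injective once the set of
coordinates with \<open>m i \<le> k i\<close> is prescribed. There are \<open>2\<^sup>d\<close> such sets.\<close>

lemma nn_integral_shift_le: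
  fixes f :: "nat^'n \<Rightarrow> ennreal"
  shows "(\<integral>\<^sup>+k. f (shift X m k) \<partial>count_space UNIV) \<le> 2 ^ CARD('n) * (\<integral>\<^sup>+k. f k \<partial>count_space UNIV)"
proof -
  define A where "A Y = {k. {i. m $ i \<le> k $ i} = Y}" for Y
  have inj: "inj_on (shift X m) (A Y)" for Y
  proof (rule inj_onI)
    fix k l assume kl: "k \<in> A Y" "l \<in> A Y" "shift X m k = shift X m l"
    have "k $ i = l $ i" for i
    proof -
      have "m $ i \<le> k $ i \<longleftrightarrow> m $ i \<le> l $ i" using kl(1,2) by (auto simp: A_def)
      moreover have "shift X m k $ i = shift X m l $ i" using kl(3) by simp
      ultimately show ?thesis by (auto simp: shift_def split: if_splits)
    qed
    then show "k = l" by (simp add: vec_eq_iff)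
  qed
  have ind: "(\<Sum>Y\<in>UNIV. indicator (A Y) k) = (1 :: ennreal)" for k
  proof -
    have "(\<Sum>Y\<in>UNIV. indicator (A Y) k :: ennreal) = (\<Sum>Y\<in>UNIV. if {i. m $ i \<le> k $ i} = Y then 1 else 0)"
      by (rule sum.cong) (auto simp: A_def)
    also have "\<dots> = 1" by (subst sum.delta') auto
    finally show ?thesis .
  qed
  have "(\<integral>\<^sup>+k. f (shift X m k) \<partial>count_space UNIV)
      = (\<integral>\<^sup>+k. (\<Sum>Y\<in>UNIV. f (shift X m k) * indicator (A Y) k) \<partial>count_space UNIV)"
    by (simp only: sum_distrib_left[symmetric] ind mult_1_right)
  also have "\<dots> = (\<Sum>Y\<in>UNIV. (\<integral>\<^sup>+k. f (shift X m k) * indicator (A Y) k \<partial>count_space UNIV))"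
    by (rule nn_integral_sum) auto
  also have "\<dots> \<le> (\<Sum>Y\<in>(UNIV :: 'n set set). (\<integral>\<^sup>+k. f k \<partial>count_space UNIV))"
  proof (rule sum_mono)
    fix Y
    have "(\<integral>\<^sup>+k. f (shift X m k) * indicator (A Y) k \<partial>count_space UNIV)
        = (\<integral>\<^sup>+k. f (shift X m k) \<partial>count_space (A Y))"
      by (subst nn_integral_count_space_indicator) (auto simp: mult.commute)
    also have "\<dots> = (\<integral>\<^sup>+k. f k \<partial>count_space (shift X m ` A Y))"
      by (rule nn_integral_bij_count_space) (rule inj_on_imp_bij_betw[OF inj])
    also have "\<dots> = (\<integral>\<^sup>+k. f k * indicator (shift X m ` A Y) k \<partial>count_space UNIV)"
      by (subst nn_integral_count_space_indicator) (auto simp: mult.commute)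
    also have "\<dots> \<le> (\<integral>\<^sup>+k. f k \<partial>count_space UNIV)"
      by (rule nn_integral_mono) (auto simp: indicator_def)
    finally show "(\<integral>\<^sup>+k. f (shift X m k) * indicator (A Y) k \<partial>count_space UNIV)
        \<le> (\<integral>\<^sup>+k. f k \<partial>count_space UNIV)" .
  qed
  also have "\<dots> = 2 ^ CARD('n) * (\<integral>\<^sup>+k. f k \<partial>count_space UNIV)"
    by (simp add: card_UNIV_set)
  finally show ?thesis .
qed

lemma barron_weight_ge_1: "1 \<le> barron_weight s k"
  by (simp add: barron_weight_def)

lemma barron_weight_nonneg: "0 \<le> barron_weight s k"
  using barron_weight_ge_1[of s k] by linarith

lemma l1_norm_nonneg: "0 \<le> l1_norm k"
  by (simp add: l1_norm_def sum_nonneg)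

text \<open>The triangle inequality \<open>\<bar>k\<bar> \<le> \<bar>m\<bar> + \<bar>k \<plusminus> m\<bar>\<close> survives the reflection of coordinates, and
\<open>(x + y) powr s \<le> 2 powr s * max x y powr s\<close>.\<close>

lemma barron_weight_submultiplicative:
  assumes "s \<ge> 0"
  shows "barron_weight s k \<le> 2 powr s * barron_weight s m * barron_weight s (shift X m k)"
proof -
  define a where "a = l1_norm m"
  define b where "b = l1_norm (shift X m k)"
  have ab: "0 \<le> a" "0 \<le> b" by (simp_all add: a_def b_def l1_norm_nonneg)
  have "l1_norm k \<le> a + b"
    unfolding a_def b_def l1_norm_def sum.distrib[symmetric]
    by (rule sum_mono) (auto simp: shift_def of_nat_diff)
  also have "\<dots> \<le> 2 * max a b" by simp
  finally have "l1_norm k powr s \<le> (2 * max a b) powr s"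
    by (intro powr_mono2 assms l1_norm_nonneg)
  also have "\<dots> = 2 powr s * max a b powr s" by (rule powr_mult)
  also have "\<dots> \<le> 2 powr s * (a powr s + b powr s)" by (intro mult_left_mono) (auto simp: max_def)
  finally have "pi powr s * l1_norm k powr s \<le> pi powr s * (2 powr s * (a powr s + b powr s))"
    by (intro mult_left_mono) auto
  moreover have "1 \<le> 2 powr s" using assms by (rule ge_one_powr_ge_zero[rotated]) simp
  ultimately have "barron_weight s k \<le> 2 powr s * (1 + pi powr s * a powr s + pi powr s * b powr s)"
    by (simp add: barron_weight_def algebra_simps)
  also have "\<dots> \<le> 2 powr s * ((1 + pi powr s * a powr s) * (1 + pi powr s * b powr s))"
    by (intro mult_left_mono) (auto simp: algebra_simps)
  finally show ?thesis by (simp add: barron_weight_def a_def b_def mult.assoc)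
qed

text \<open>Values in \<open>ennreal\<close> allow summation in any order before finiteness is known. The factor
\<open>1 / 2\<^sup>d\<close> makes the operator an average over the choices of sign.\<close>

definition reflected_convolution :: "(nat^'n \<Rightarrow> real) \<Rightarrow> (nat^'n \<Rightarrow> ennreal) \<Rightarrow> nat^'n \<Rightarrow> ennreal" where
  "reflected_convolution v f k =
     (\<integral>\<^sup>+m. ennreal (\<bar>v m\<bar> * (1 / 2 ^ CARD('n))) * (\<Sum>X\<in>UNIV. f (shift X m k)) \<partial>count_space UNIV)"

lemma reflected_convolution_mono:
  "(\<And>k. f k \<le> h k) \<Longrightarrow> reflected_convolution v f k \<le> reflected_convolution v h k"
  unfolding reflected_convolution_def by (intro nn_integral_mono mult_left_mono sum_mono) auto

lemma reflected_convolution_add: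
  "reflected_convolution v (\<lambda>k. f k + h k) k = reflected_convolution v f k + reflected_convolution v h k"
  unfolding reflected_convolution_def
  by (subst nn_integral_add[symmetric]) (auto simp: sum.distrib distrib_left)

lemma reflected_convolution_const:
  fixes v :: "nat^'n \<Rightarrow> real"
  shows "reflected_convolution v (\<lambda>_. c) k = (\<integral>\<^sup>+m. ennreal \<bar>v m\<bar> \<partial>count_space UNIV) * c"
proof -
  have "ennreal (\<bar>v m\<bar> * (1 / 2 ^ CARD('n))) * (\<Sum>X\<in>(UNIV :: 'n set set). c) = ennreal \<bar>v m\<bar> * c" for m
  proof -
    have c: "(\<Sum>X\<in>(UNIV :: 'n set set). c) = ennreal (2 ^ CARD('n)) * c"
      by (simp add: card_UNIV_set ennreal_power[symmetric])
    have "ennreal (\<bar>v m\<bar> * (1 / 2 ^ CARD('n))) * ennreal (2 ^ CARD('n)) = ennreal \<bar>v m\<bar>"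
      by (subst ennreal_mult[symmetric]) auto
    then show ?thesis unfolding c by (simp only: mult.assoc[symmetric])
  qed
  then show ?thesis unfolding reflected_convolution_def by (simp add: nn_integral_multc)
qed

text \<open>Submultiplicativity distributes the weight of \<open>k\<close> to \<open>m\<close> and to the shifted frequency; then the sum
over \<open>k\<close> is estimated for each \<open>m\<close> by \<open>nn_integral_shift_le\<close>. This is Young's inequality for the
weighted \<open>\<ell>\<^sup>1\<close> space.\<close>

lemma reflected_convolution_weighted:
  fixes v :: "nat^'n \<Rightarrow> real"
  assumes s: "s \<ge> 0"
  shows "(\<integral>\<^sup>+k. ennreal (barron_weight s k) * reflected_convolution v f k \<partial>count_space UNIV)
     \<le> ennreal (2 powr s) * 2 ^ CARD('n) * (\<integral>\<^sup>+m. ennreal (barron_weight s m * \<bar>v m\<bar>) \<partial>count_space UNIV)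
        * (\<integral>\<^sup>+k. ennreal (barron_weight s k) * f k \<partial>count_space UNIV)" (is "_ \<le> ?R")
proof -
  define w where "w k = ennreal (barron_weight s (k :: nat^'n))" for k
  define c where "c m = ennreal (\<bar>v m\<bar> * (1 / 2 ^ CARD('n)))" for m
  define N where "N = (\<integral>\<^sup>+k. w k * f k \<partial>count_space UNIV)"
  have w: "w k \<le> ennreal (2 powr s) * w m * w (shift X m k)" for k m X
    using ennreal_leI[OF barron_weight_submultiplicative[OF s, of k m X]]
    unfolding w_def by (simp add: ennreal_mult barron_weight_nonneg)
  have single: "(\<integral>\<^sup>+k. w k * f (shift X m k) \<partial>count_space UNIV) \<le> ennreal (2 powr s) * w m * (2 ^ CARD('n) * N)" for m X
  proof -
    have "(\<integral>\<^sup>+k. w k * f (shift X m k) \<partial>count_space UNIV)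
       \<le> (\<integral>\<^sup>+k. ennreal (2 powr s) * w m * (w (shift X m k) * f (shift X m k)) \<partial>count_space UNIV)"
      using mult_right_mono[OF w] by (intro nn_integral_mono) (simp add: mult.assoc)
    also have "\<dots> = ennreal (2 powr s) * w m * (\<integral>\<^sup>+k. w (shift X m k) * f (shift X m k) \<partial>count_space UNIV)"
      by (simp add: nn_integral_cmult)
    also have "\<dots> \<le> ennreal (2 powr s) * w m * (2 ^ CARD('n) * N)"
      unfolding N_def by (intro mult_left_mono nn_integral_shift_le) auto
    finally show ?thesis .
  qed
  have "(\<integral>\<^sup>+k. w k * reflected_convolution v f k \<partial>count_space UNIV)
     = (\<integral>\<^sup>+k. (\<integral>\<^sup>+m. c m * (\<Sum>X\<in>UNIV. w k * f (shift X m k)) \<partial>count_space UNIV) \<partial>count_space UNIV)"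
  proof (rule nn_integral_cong)
    fix k
    have "w k * reflected_convolution v f k = (\<integral>\<^sup>+m. w k * (c m * (\<Sum>X\<in>UNIV. f (shift X m k))) \<partial>count_space UNIV)"
      unfolding reflected_convolution_def c_def by (rule nn_integral_cmult[symmetric]) simp
    also have "\<dots> = (\<integral>\<^sup>+m. c m * (\<Sum>X\<in>UNIV. w k * f (shift X m k)) \<partial>count_space UNIV)"
      by (simp add: sum_distrib_left[symmetric] mult.left_commute)
    finally show "w k * reflected_convolution v f k
       = (\<integral>\<^sup>+m. c m * (\<Sum>X\<in>UNIV. w k * f (shift X m k)) \<partial>count_space UNIV)" .
  qed
  also have "\<dots> = (\<integral>\<^sup>+m. (\<integral>\<^sup>+k. c m * (\<Sum>X\<in>UNIV. w k * f (shift X m k)) \<partial>count_space UNIV) \<partial>count_space UNIV)"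
    by (rule nn_integral_count_space_nn_integral) auto
  also have "\<dots> = (\<integral>\<^sup>+m. c m * (\<Sum>X\<in>UNIV. (\<integral>\<^sup>+k. w k * f (shift X m k) \<partial>count_space UNIV)) \<partial>count_space UNIV)"
    by (simp add: nn_integral_cmult nn_integral_sum)
  also have "\<dots> \<le> (\<integral>\<^sup>+m. c m * (\<Sum>X\<in>(UNIV :: 'n set set). ennreal (2 powr s) * w m * (2 ^ CARD('n) * N)) \<partial>count_space UNIV)"
    by (intro nn_integral_mono mult_left_mono sum_mono single) auto
  also have "\<dots> = (\<integral>\<^sup>+m. ennreal (barron_weight s m * \<bar>v m\<bar>) * (ennreal (2 powr s) * 2 ^ CARD('n) * N) \<partial>count_space UNIV)"
  proof (rule nn_integral_cong)
    fix m
    have "c m * (\<Sum>X\<in>(UNIV :: 'n set set). ennreal (2 powr s) * w m * (2 ^ CARD('n) * N))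
        = (c m * 2 ^ CARD('n)) * w m * (ennreal (2 powr s) * 2 ^ CARD('n) * N)"
      by (simp add: card_UNIV_set mult_ac)
    also have "c m * 2 ^ CARD('n) = ennreal (\<bar>v m\<bar> * (1 / 2 ^ CARD('n)) * 2 ^ CARD('n))"
    proof -
      have two: "(2 :: ennreal) ^ CARD('n) = ennreal (2 ^ CARD('n))" by (simp add: ennreal_power[symmetric])
      show ?thesis unfolding c_def two by (subst ennreal_mult[symmetric]) auto
    qed
    also have "\<dots> * w m = ennreal (barron_weight s m * \<bar>v m\<bar>)"
      unfolding w_def using barron_weight_ge_1[of s m] by (simp add: ennreal_mult[symmetric] mult.commute)
    finally show "c m * (\<Sum>X\<in>(UNIV :: 'n set set). ennreal (2 powr s) * w m * (2 ^ CARD('n) * N))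
       = ennreal (barron_weight s m * \<bar>v m\<bar>) * (ennreal (2 powr s) * 2 ^ CARD('n) * N)" .
  qed
  also have "\<dots> = ?R" by (subst nn_integral_multc) (auto simp: N_def w_def mult_ac)
  finally show ?thesis by (simp add: w_def)
qed

lemma has_sum_abs_le_nn_integral:
  fixes f :: "'a::countable \<Rightarrow> real"
  assumes "(f has_sum c) UNIV"
  shows "ennreal \<bar>c\<bar> \<le> (\<integral>\<^sup>+m. ennreal \<bar>f m\<bar> \<partial>count_space UNIV)"
proof (rule tendsto_upperbound)
  show "((\<lambda>F. ennreal \<bar>sum f F\<bar>) \<longlongrightarrow> ennreal \<bar>c\<bar>) (finite_subsets_at_top UNIV)"
    using assms unfolding has_sum_def by (intro tendsto_ennrealI tendsto_rabs)
  have le: "ennreal \<bar>sum f F\<bar> \<le> (\<integral>\<^sup>+m. ennreal \<bar>f m\<bar> \<partial>count_space UNIV)" if "finite F" for F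
  proof -
    have "ennreal \<bar>sum f F\<bar> \<le> ennreal (\<Sum>m\<in>F. \<bar>f m\<bar>)" by (intro ennreal_leI sum_abs)
    also have "\<dots> = (\<Sum>m\<in>F. ennreal \<bar>f m\<bar>)" by (simp add: sum_ennreal)
    also have "\<dots> \<le> (SUP F\<in>{F. finite F \<and> F \<subseteq> UNIV}. \<Sum>m\<in>F. ennreal \<bar>f m\<bar>)"
      by (rule SUP_upper) (use that in auto)
    also have "\<dots> = (\<Sum>\<^sub>\<infinity>m. ennreal \<bar>f m\<bar>)" by (rule nonneg_infsum_complete[symmetric]) auto
    also have "\<dots> = (\<integral>\<^sup>+m. ennreal \<bar>f m\<bar> \<partial>count_space UNIV)" by (simp add: infsum_ennreal_eq_nn_integral)
    finally show ?thesis .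
  qed
  show "\<forall>\<^sub>F F in finite_subsets_at_top UNIV. ennreal \<bar>sum f F\<bar> \<le> (\<integral>\<^sup>+m. ennreal \<bar>f m\<bar> \<partial>count_space UNIV)"
    by (rule eventually_finite_subsets_at_top_weakI) (rule le)
qed simp

lemma finite_frequency_sq_less: "finite {k :: nat^'n. frequency_sq k < c}"
proof -
  define M where "M = nat \<lceil>c\<rceil>"
  have "k $ i \<le> M" if "frequency_sq k < c" for k :: "nat^'n" and i
  proof -
    have "real (k $ i) \<le> (real (k $ i))\<^sup>2" by (cases "k $ i") (auto simp: power2_eq_square)
    also have "\<dots> \<le> (pi * real (k $ i))\<^sup>2" using pi_gt3 by (intro power_mono) (auto simp: mult_le_cancel_right1)
    also have "\<dots> \<le> frequency_sq k" unfolding frequency_sq_def by (rule member_le_sum) auto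
    finally show ?thesis using that unfolding M_def by linarith
  qed
  then have "vec_nth ` {k :: nat^'n. frequency_sq k < c} \<subseteq> (PiE UNIV (\<lambda>_. {..M}))" by auto
  moreover have "finite (PiE (UNIV :: 'n set) (\<lambda>_. {..M}))" by (intro finite_PiE) auto
  ultimately have "finite (vec_nth ` {k :: nat^'n. frequency_sq k < c})" by (rule finite_subset)
  then show ?thesis by (rule finite_imageD) (auto intro: inj_onI simp: vec_nth_inject)
qed

text \<open>By Cauchy-Schwarz \<open>\<bar>k\<bar>\<^sub>1\<^sup>2 \<le> d \<bar>k\<bar>\<^sup>2\<close>, so two extra orders of the weight cost one factor of the
symbol of the Laplacian.\<close>

lemma barron_weight_add_2:
  fixes k :: "nat^'n"
  shows "barron_weight (s + 2) k \<le> barron_weight s k * (1 + real CARD('n) * frequency_sq k)"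
proof -
  define p where "p = pi powr s * l1_norm k powr s"
  have "(pi * l1_norm k)\<^sup>2 = (\<Sum>i\<in>UNIV. pi * real (k $ i))\<^sup>2" by (simp add: l1_norm_def sum_distrib_left)
  also have "\<dots> \<le> real CARD('n) * frequency_sq k"
    unfolding frequency_sq_def by (subst mult.commute) (rule sum_squared_le_sum_of_squares)
  finally have le: "(pi * l1_norm k)\<^sup>2 \<le> real CARD('n) * frequency_sq k" .
  have "barron_weight (s + 2) k = 1 + p * (pi * l1_norm k)\<^sup>2"
    by (simp add: barron_weight_def p_def powr_add l1_norm_nonneg power_mult_distrib)
  also have "\<dots> \<le> 1 + p * (real CARD('n) * frequency_sq k)" by (intro add_left_mono mult_left_mono le) (simp add: p_def)
  also have "\<dots> \<le> (1 + p) * (1 + real CARD('n) * frequency_sq k)"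
    using order_trans[OF zero_le_power2 le] by (simp add: algebra_simps p_def)
  finally show ?thesis by (simp add: barron_weight_def p_def)
qed

section \<open>Regularity of eigenfunctions\<close>

lemma summable_of_cosine_barron:
  fixes V :: "real^'n \<Rightarrow> real"
  assumes "V \<in> cosine_barron s"
  shows "(\<integral>\<^sup>+m. ennreal (barron_weight s m * \<bar>cosine_coefficient V m\<bar>) \<partial>count_space UNIV) < \<infinity>"
    and "(\<lambda>m. \<bar>cosine_coefficient V m\<bar>) summable_on UNIV"
proof -
  let ?f = "\<lambda>m. barron_weight s m * \<bar>cosine_coefficient V m\<bar>"
  have fin: "(\<Sum>\<^sub>\<infinity>m. ennreal (?f m)) < \<infinity>"
    using assms by (simp add: cosine_barron_def cosine_barron_norm_def)
  then show "(\<integral>\<^sup>+m. ennreal (?f m) \<partial>count_space UNIV) < \<infinity>"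
    by (simp add: infsum_ennreal_eq_nn_integral)
  obtain B where B: "(\<Sum>\<^sub>\<infinity>m. ennreal (?f m)) = ennreal B" "0 \<le> B"
    using fin by (cases "\<Sum>\<^sub>\<infinity>m. ennreal (?f m)") auto
  show "(\<lambda>m. \<bar>cosine_coefficient V m\<bar>) summable_on UNIV"
  proof (rule nonneg_bdd_above_summable_on)
    show "bdd_above (sum (\<lambda>m. \<bar>cosine_coefficient V m\<bar>) ` {F. F \<subseteq> UNIV \<and> finite F})"
    proof (rule bdd_aboveI2)
      fix F :: "(nat^'n) set" assume F: "F \<in> {F. F \<subseteq> UNIV \<and> finite F}"
      have "ennreal (\<Sum>m\<in>F. ?f m) = (\<Sum>m\<in>F. ennreal (?f m))"
        by (rule sum_ennreal[symmetric]) (simp add: barron_weight_nonneg)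
      also have "\<dots> \<le> (SUP F\<in>{F. finite F \<and> F \<subseteq> UNIV}. \<Sum>m\<in>F. ennreal (?f m))"
        by (rule SUP_upper) (use F in auto)
      also have "\<dots> = ennreal B"
        unfolding B(1)[symmetric] by (rule nonneg_infsum_complete[symmetric]) auto
      finally have "(\<Sum>m\<in>F. ?f m) \<le> B" using B(2) by simp
      moreover have "(\<Sum>m\<in>F. \<bar>cosine_coefficient V m\<bar>) \<le> (\<Sum>m\<in>F. ?f m)"
        by (rule sum_mono) (use barron_weight_ge_1 in \<open>auto simp: mult_le_cancel_right1\<close>)
      ultimately show "(\<Sum>m\<in>F. \<bar>cosine_coefficient V m\<bar>) \<le> B" by linarith
    qed
  qed auto
qed

text \<open>The coefficients of \<open>V u\<close> are obtained by integrating the cosine series of \<open>V\<close> against \<open>u \<Phi>\<^sub>k\<close>, which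
is integrable, term by term.\<close>

lemma eigenfunction_convolution_bound:
  fixes V u :: "real^'n \<Rightarrow> real"
  assumes V: "V \<in> cosine_barron s" and u: "dirichlet_eigenfunction V lam u"
  shows "ennreal (\<bar>frequency_sq k - lam\<bar> * \<bar>\<integral>x. u x * sin_basis k x \<partial>cube_measure\<bar>)
     \<le> reflected_convolution (cosine_coefficient V) (\<lambda>k. ennreal \<bar>\<integral>x. u x * sin_basis k x \<partial>cube_measure\<bar>) k"
proof -
  define v where "v = cosine_coefficient V"
  have uint: "integrable cube_measure u"
    using u H1_0D(1)[of u] by (intro L2_integrable) (simp add: dirichlet_eigenfunction_def)
  have Vint: "integrable cube_measure V" using V by (simp add: cosine_barron_def)
  obtain B where B: "AE x in cube_measure. \<bar>V x\<bar> \<le> B"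
    using cosine_series_bounded[OF Vint summable_of_cosine_barron(2)[OF V]] by blast
  have "integrable cube_measure (\<lambda>x. u x * V x)"
    by (rule integrable_mult_bounded[OF uint _ B]) (rule borel_measurable_integrable[OF Vint])
  then have Vu: "integrable cube_measure (\<lambda>x. V x * u x)" by (simp add: mult.commute)
  have us: "integrable cube_measure (\<lambda>x. u x * sin_basis k x)"
    by (intro integrable_mult_continuous uint continuous_sin_basis)
  have "\<bar>frequency_sq k - lam\<bar> * \<bar>\<integral>x. u x * sin_basis k x \<partial>cube_measure\<bar>
     = \<bar>\<integral>x. V x * (u x * sin_basis k x) \<partial>cube_measure\<bar>"
    using eigenfunction_fourier_equation[OF u Vu, of k] by (simp add: abs_mult[symmetric])
  also have "ennreal \<dots> \<le> (\<integral>\<^sup>+m. ennreal \<bar>v m * (\<integral>x. (u x * sin_basis k x) * cos_basis m x \<partial>cube_measure)\<bar> \<partial>count_space UNIV)"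
    unfolding v_def
    by (rule has_sum_abs_le_nn_integral[OF cosine_series_has_sum[OF Vint summable_of_cosine_barron(2)[OF V] us]])
  also have "\<dots> \<le> reflected_convolution v (\<lambda>k. ennreal \<bar>\<integral>x. u x * sin_basis k x \<partial>cube_measure\<bar>) k"
    unfolding reflected_convolution_def
  proof (rule nn_integral_mono)
    fix m
    have "\<bar>v m * (\<integral>x. (u x * sin_basis k x) * cos_basis m x \<partial>cube_measure)\<bar>
      \<le> \<bar>v m\<bar> * ((1 / 2 ^ CARD('n)) * (\<Sum>X\<in>UNIV. \<bar>\<integral>x. u x * sin_basis (shift X m k) x \<partial>cube_measure\<bar>))"
      unfolding abs_mult by (intro mult_left_mono abs_integral_sin_cos_le uint) auto
    then have "ennreal \<bar>v m * (\<integral>x. (u x * sin_basis k x) * cos_basis m x \<partial>cube_measure)\<bar>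
      \<le> ennreal ((\<bar>v m\<bar> * (1 / 2 ^ CARD('n))) * (\<Sum>X\<in>UNIV. \<bar>\<integral>x. u x * sin_basis (shift X m k) x \<partial>cube_measure\<bar>))"
      by (intro ennreal_leI) (simp only: mult.assoc)
    also have "\<dots> = ennreal (\<bar>v m\<bar> * (1 / 2 ^ CARD('n))) * (\<Sum>X\<in>UNIV. ennreal \<bar>\<integral>x. u x * sin_basis (shift X m k) x \<partial>cube_measure\<bar>)"
      by (subst ennreal_mult) (auto simp: sum_ennreal intro!: sum_nonneg)
    finally show "ennreal \<bar>v m * (\<integral>x. (u x * sin_basis k x) * cos_basis m x \<partial>cube_measure)\<bar>
      \<le> ennreal (\<bar>v m\<bar> * (1 / 2 ^ CARD('n))) * (\<Sum>X\<in>UNIV. ennreal \<bar>\<integral>x. u x * sin_basis (shift X m k) x \<partial>cube_measure\<bar>)" .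
  qed
  finally show ?thesis by (simp add: v_def)
qed

theorem theorem9:
  fixes V u :: "real^'n \<Rightarrow> real" and s lam :: real
  assumes "s \<ge> 0"
    and "V \<in> cosine_barron s"
    and "dirichlet_eigenfunction V lam u"
  shows "u \<in> sine_barron (s + 2)"
proof -
  define v where "v = cosine_coefficient V"
  define r where "r k = \<bar>\<integral>x. u x * sin_basis k x \<partial>cube_measure\<bar>" for k
  define b where "b k = ennreal (r k)" for k
  define w where "w k = ennreal (barron_weight s (k :: nat^'n))" for k
  define Q where "Q = reflected_convolution v"
  have r: "r k \<ge> 0" for k by (simp add: r_def)
  have uint: "integrable cube_measure u"
    using assms(3) H1_0D(1)[of u] by (intro L2_integrable) (simp add: dirichlet_eigenfunction_def)
  have eq: "ennreal (\<bar>frequency_sq k - lam\<bar> * r k) \<le> Q b k" for k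
    using eigenfunction_convolution_bound[OF assms(2,3), of k] by (simp add: Q_def v_def b_def[abs_def] r_def)
  define Nw where "Nw = (\<integral>\<^sup>+m. ennreal (barron_weight s m * \<bar>v m\<bar>) \<partial>count_space UNIV)"
  have Nw: "Nw < \<infinity>" unfolding Nw_def v_def by (rule summable_of_cosine_barron(1)[OF assms(2)])
  define A where "A = ennreal (2 powr s) * 2 ^ CARD('n) * Nw"
  have "A < \<infinity>"
    using Nw by (auto simp: A_def ennreal_mult_less_top ennreal_power[symmetric] power_less_top_ennreal)
  then obtain L0 where L0: "A = ennreal L0" "L0 \<ge> 0" by (cases A) auto
  \<comment> \<open>Adding \<open>1\<close> keeps the common operator bound positive, so that it can be divided by.\<close>
  define L where "L = L0 + 1"
  have L: "L > 0" "A \<le> ennreal L" using L0 by (auto simp: L_def intro: ennreal_leI)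
  have "1 \<le> 2 powr s * 2 ^ CARD('n)"
    using ge_one_powr_ge_zero[of 2 s] assms(1) by (intro mult_ge1_I) auto
  then have "1 \<le> ennreal (2 powr s) * 2 ^ CARD('n)"
    by (metis ennreal_1 ennreal_leI ennreal_mult ennreal_numeral ennreal_power powr_ge_zero zero_le_numeral zero_le_power)
  then have "Nw \<le> A" using mult_right_mono[of 1 "ennreal (2 powr s) * 2 ^ CARD('n)" Nw] by (simp add: A_def)
  moreover have "(\<integral>\<^sup>+m. ennreal \<bar>v m\<bar> \<partial>count_space UNIV) \<le> Nw"
    unfolding Nw_def using barron_weight_ge_1
    by (intro nn_integral_mono ennreal_leI) (auto simp: mult_le_cancel_right1)
  ultimately have N0: "(\<integral>\<^sup>+m. ennreal \<bar>v m\<bar> \<partial>count_space UNIV) \<le> ennreal L" using L by order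
  have Qconst: "Q (\<lambda>_. c) k \<le> ennreal L * c" for c k
    unfolding Q_def reflected_convolution_const by (intro mult_right_mono N0) auto
  have Qw: "(\<integral>\<^sup>+k. w k * Q f k \<partial>count_space UNIV) \<le> ennreal L * (\<integral>\<^sup>+k. w k * f k \<partial>count_space UNIV)" for f
  proof -
    have "(\<integral>\<^sup>+k. w k * Q f k \<partial>count_space UNIV) \<le> A * (\<integral>\<^sup>+k. w k * f k \<partial>count_space UNIV)"
      using reflected_convolution_weighted[OF assms(1), of v f]
      by (simp add: Q_def w_def A_def Nw_def)
    also have "\<dots> \<le> ennreal L * (\<integral>\<^sup>+k. w k * f k \<partial>count_space UNIV)" by (intro mult_right_mono L) auto
    finally show ?thesis .
  qed
  define \<epsilon> where "\<epsilon> = ennreal (1 / (2 * L))"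
  have \<epsilon>L: "\<epsilon> * (ennreal L * c) = c / 2" for c
  proof -
    have "\<epsilon> * ennreal L = ennreal (1 / 2)" unfolding \<epsilon>_def using L by (subst ennreal_mult[symmetric]) auto
    also have "\<dots> = inverse 2" using inverse_ennreal[of 2] by (simp add: inverse_eq_divide)
    finally show ?thesis by (simp add: divide_ennreal_def mult.assoc[symmetric] mult.commute)
  qed
  \<comment> \<open>Off \<open>E\<close> dividing the equation by \<open>frequency_sq k - lam \<ge> 2 L\<close> costs at most the factor \<open>\<epsilon>\<close>, and \<open>\<epsilon> Q\<close> contracts by \<open>1/2\<close>.\<close>
  define E where "E = {k :: nat^'n. frequency_sq k < lam + 2 * L}"
  have finE: "finite E" unfolding E_def by (rule finite_frequency_sq_less)
  define S where "S f k = \<epsilon> * Q f k" for f k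
  have fin: "(\<integral>\<^sup>+k. w k * b k \<partial>count_space UNIV) < \<infinity>"
  proof (rule weighted_sum_finite_of_contraction[where S=S and g="\<lambda>k. b k * indicator E k" and M="ennreal (\<integral>x. \<bar>u x\<bar> \<partial>cube_measure)"])
    show "S f k \<le> S h k" if "\<And>k. f k \<le> h k" for f h k
      unfolding S_def Q_def by (intro mult_left_mono reflected_convolution_mono that) auto
    show "S (\<lambda>k. f k + h k) k \<le> S f k + S h k" for f h k
      unfolding S_def Q_def reflected_convolution_add by (simp add: distrib_left)
    show "S (\<lambda>_. c) k \<le> c / 2" for c k
      unfolding S_def \<epsilon>L[symmetric] by (intro mult_left_mono Qconst) auto
    show "(\<integral>\<^sup>+k. w k * S f k \<partial>count_space UNIV) \<le> (\<integral>\<^sup>+k. w k * f k \<partial>count_space UNIV) / 2" for f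
    proof -
      have "(\<integral>\<^sup>+k. w k * S f k \<partial>count_space UNIV) = \<epsilon> * (\<integral>\<^sup>+k. w k * Q f k \<partial>count_space UNIV)"
        by (simp add: S_def nn_integral_cmult[symmetric] mult.left_commute)
      also have "\<dots> \<le> (\<integral>\<^sup>+k. w k * f k \<partial>count_space UNIV) / 2"
        unfolding \<epsilon>L[symmetric] by (intro mult_left_mono Qw) auto
      finally show ?thesis .
    qed
    show "b k \<le> b k * indicator E k + S b k" for k
    proof (cases "k \<in> E")
      case False
      then have "2 * L * r k \<le> \<bar>frequency_sq k - lam\<bar> * r k" using r by (intro mult_right_mono) (auto simp: E_def)
      then have "ennreal (2 * L * r k) \<le> Q b k" using eq[of k] by (meson ennreal_leI order_trans)
      then have "\<epsilon> * ennreal (2 * L * r k) \<le> S b k" unfolding S_def by (rule mult_left_mono) auto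
      moreover have "\<epsilon> * ennreal (2 * L * r k) = b k"
        unfolding \<epsilon>_def b_def using L r by (subst ennreal_mult[symmetric]) auto
      ultimately show ?thesis using False by simp
    qed simp
    show "b k \<le> ennreal (\<integral>x. \<bar>u x\<bar> \<partial>cube_measure)" for k
    proof -
      have "r k \<le> (\<integral>x. \<bar>u x\<bar> \<partial>cube_measure)"
        unfolding r_def
      proof (rule integral_abs_bound[THEN order_trans], rule integral_mono)
        show "integrable cube_measure (\<lambda>x. \<bar>u x * sin_basis k x\<bar>)"
          using integrable_mult_continuous[OF uint continuous_sin_basis] by auto
        show "\<bar>u x * sin_basis k x\<bar> \<le> \<bar>u x\<bar>" for x
          by (simp add: abs_mult mult_left_le abs_sin_basis_le)
      qed (use uint in auto)
      then show ?thesis unfolding b_def by (rule ennreal_leI)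
    qed
    show "(\<integral>\<^sup>+k. w k * (b k * indicator E k) \<partial>count_space UNIV) < \<infinity>"
    proof -
      have "(\<integral>\<^sup>+k. w k * (b k * indicator E k) \<partial>count_space UNIV) = (\<integral>\<^sup>+k. w k * b k \<partial>count_space E)"
        by (subst nn_integral_count_space_indicator) (auto simp: mult_ac)
      also have "\<dots> = (\<Sum>k\<in>E. w k * b k)" by (rule nn_integral_count_space_finite[OF finE])
      also have "\<dots> < \<infinity>" using finE by (simp add: w_def b_def ennreal_mult_less_top)
      finally show ?thesis .
    qed
  qed simp
  \<comment> \<open>The gain of two orders: \<open>frequency_sq k \<le> \<bar>lam\<bar> + \<bar>frequency_sq k - lam\<bar>\<close>, and the second term is controlled by the equation.\<close>
  define W where "W = (\<integral>\<^sup>+k. w k * b k \<partial>count_space UNIV)"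
  define d where "d = real CARD('n)"
  have weight: "ennreal (barron_weight (s + 2) k * \<bar>sine_coefficient u k\<bar>)
      \<le> ennreal (2 ^ CARD('n)) * (ennreal (1 + d * \<bar>lam\<bar>) * (w k * b k) + ennreal d * (w k * Q b k))" for k
  proof -
    have d: "d \<ge> 0" by (simp add: d_def)
    have "1 + d * frequency_sq k \<le> (1 + d * \<bar>lam\<bar>) + d * \<bar>frequency_sq k - lam\<bar>"
      using mult_left_mono[of "frequency_sq k" "\<bar>lam\<bar> + \<bar>frequency_sq k - lam\<bar>" d] d by (simp add: distrib_left)
    then have "barron_weight s k * (1 + d * frequency_sq k) \<le> barron_weight s k * ((1 + d * \<bar>lam\<bar>) + d * \<bar>frequency_sq k - lam\<bar>)"
      by (intro mult_left_mono barron_weight_nonneg)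
    then have "barron_weight (s + 2) k \<le> barron_weight s k * ((1 + d * \<bar>lam\<bar>) + d * \<bar>frequency_sq k - lam\<bar>)"
      using barron_weight_add_2[of s k] unfolding d_def by linarith
    then have "barron_weight (s + 2) k * r k
       \<le> barron_weight s k * ((1 + d * \<bar>lam\<bar>) + d * \<bar>frequency_sq k - lam\<bar>) * r k"
      using r by (intro mult_right_mono)
    also have "\<dots> = (1 + d * \<bar>lam\<bar>) * (barron_weight s k * r k) + d * (barron_weight s k * (\<bar>frequency_sq k - lam\<bar> * r k))"
      by (simp add: algebra_simps)
    finally have "ennreal (barron_weight (s + 2) k * r k)
      \<le> ennreal ((1 + d * \<bar>lam\<bar>) * (barron_weight s k * r k) + d * (barron_weight s k * (\<bar>frequency_sq k - lam\<bar> * r k)))"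
      by (rule ennreal_leI)
    also have "\<dots> = ennreal (1 + d * \<bar>lam\<bar>) * (w k * b k) + ennreal d * (w k * ennreal (\<bar>frequency_sq k - lam\<bar> * r k))"
      unfolding w_def b_def using d r by (simp add: ennreal_plus ennreal_mult barron_weight_nonneg del: ennreal_plus[symmetric])
    also have "\<dots> \<le> ennreal (1 + d * \<bar>lam\<bar>) * (w k * b k) + ennreal d * (w k * Q b k)"
      by (intro add_left_mono mult_left_mono eq) auto
    finally have "ennreal (2 ^ CARD('n)) * ennreal (barron_weight (s + 2) k * r k)
      \<le> ennreal (2 ^ CARD('n)) * (ennreal (1 + d * \<bar>lam\<bar>) * (w k * b k) + ennreal d * (w k * Q b k))"
      by (rule mult_left_mono) auto
    moreover have "ennreal (2 ^ CARD('n)) * ennreal (barron_weight (s + 2) k * r k)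
       = ennreal (barron_weight (s + 2) k * \<bar>sine_coefficient u k\<bar>)"
      using r by (subst ennreal_mult[symmetric])
        (auto simp: barron_weight_nonneg sine_coefficient_def r_def abs_mult mult.left_commute)
    ultimately show ?thesis by simp
  qed
  have "sine_barron_norm (s + 2) u
     \<le> (\<integral>\<^sup>+k. ennreal (barron_weight (s + 2) k * \<bar>sine_coefficient u k\<bar>) \<partial>count_space UNIV)"
    unfolding sine_barron_norm_def infsum_ennreal_eq_nn_integral
    by (rule nn_integral_mono) (auto simp: indicator_def)
  also have "\<dots> \<le> (\<integral>\<^sup>+k. ennreal (2 ^ CARD('n)) * (ennreal (1 + d * \<bar>lam\<bar>) * (w k * b k) + ennreal d * (w k * Q b k)) \<partial>count_space UNIV)"
    by (rule nn_integral_mono) (rule weight)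
  also have "\<dots> = ennreal (2 ^ CARD('n)) * (ennreal (1 + d * \<bar>lam\<bar>) * W + ennreal d * (\<integral>\<^sup>+k. w k * Q b k \<partial>count_space UNIV))"
    by (simp add: nn_integral_cmult nn_integral_add W_def)
  also have "\<dots> \<le> ennreal (2 ^ CARD('n)) * (ennreal (1 + d * \<bar>lam\<bar>) * W + ennreal d * (ennreal L * W))"
    unfolding W_def by (intro mult_left_mono add_left_mono Qw) auto
  also have "\<dots> < \<infinity>" using fin by (simp add: W_def[symmetric] ennreal_mult_less_top)
  finally show ?thesis using uint by (simp add: sine_barron_def)
qed

end
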